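(* Let $d\ge2$, $k\in\{0,\ldots,d-2\}$ and let $F$ be a self-similar set in $\mathbb{R}^d$ satisfying the open set condition OSC and the regularity condition RC. Then the validity of the curvature bound condition CBC (for the index $k$) is independent of the choice of the open set $O$; i.e., if $O_1$ and $O_2$ are two open sets each satisfying the strong open set condition SOSC for $F$, then CBC with $O=O_1$ is satisfied if and only if CBC with $O=O_2$ is satisfied.
   Context: Parallel sets and curvature measures. For $K\subset\mathbb{R}^d$ and $\varepsilon\ge0$ put $K_\varepsilon:=\{x\in\mathbb{R}^d:\mathrm{dist}(x,K)\le\varepsilon\}$. For compact $K$, let $\widetilde{K}$ be the closure of the complement of $K$. A distance $\varepsilon\ge 0$ is called regular for the compact set $K$ if $\widetilde{K_\varepsilon}$ has positive reach in the sense of Federer and the boundary $\partial K_\varepsilon$ is a Lipschitz manifold. For regular $\varepsilon$ and $k\in\{0,\ldots,d-1\}$ define the signed measure $C_k(K_\varepsilon,\cdot):=(-1)^{d-1-k}C_k(\widetilde{K_\varepsilon},\cdot)$, where on the right $C_k$ denotes Federer's $k$-th (Lipschitz-Killing) curvature measure of a set of positive reach. $C_k^{\mathrm{var}}(K_\varepsilon,\cdot)$ is the total variation measure of $C_k(K_\varepsilon,\cdot)$. Self-similar sets. $F$ is the unique nonempty compact set with $F=\bigcup_{i=1}^N S_iF$, where $S_1,\ldots,S_N:\mathbb{R}^d\to\mathbb{R}^d$ are contracting similarities with ratios $r_i\in(0,1)$; write $\mathbf{S}(A):=\bigcup_{i=1}^N S_i(A)$. OSC: there is a nonempty bounded open set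 $O$ with $\bigcup_iS_iO\subseteq O$ and $S_iO\cap S_jO=\emptyset$ for $i\ne j$. An open set $O$ satisfies SOSC for $F$ if it is as in OSC and additionally $O\cap F\neq\emptyset$ (in $\mathbb{R}^d$, OSC implies that such an $O$ exists). RC: almost all $\varepsilon\in(0,\sqrt2\,\mathrm{diam}F)$ are regular for $F$. (There are no irregular values $\varepsilon\ge\sqrt2\,\mathrm{diam}F$.) Words. $\Sigma^*:=\bigcup_{j\ge0}\{1,\ldots,N\}^j$; for $\omega=\omega_1\cdots\omega_n\in\Sigma^*$, $|\omega|=n$, $\omega|m=\omega_1\cdots\omega_m$ for $m\le n$, $r_\omega=r_{\omega_1}\cdots r_{\omega_n}$, $S_\omega=S_{\omega_1}\circ\cdots\circ S_{\omega_n}$ (with $r_\emptyset=1$). Fix a constant $R>\sqrt2\,\mathrm{diam}F$. For $0<\varepsilon\le R$ let $\Sigma(\varepsilon)$ be the set of all words $\omega\in\Sigma^*$ (of length at least $1$) with $Rr_\omega<\varepsilon\le Rr_{\omega|(|\omega|-1)}$. Given an open set $O$ satisfying SOSC for $F$, let $\Sigma_b(\varepsilon):=\{\omega\in\Sigma(\varepsilon):(S_\omega F)_\varepsilon\cap((\mathbf{S}O)^c)_\varepsilon\ne\emptyset\}$, where $(\mathbf{S}O)^c$ is the complement of $\mathbf{S}O$; this family depends on $O$. CBC (for the index $k$, with open set $O$): there is a constant $c_k$ such that for almost all $\varepsilon\in(0,R)$ and all $\sigma\in\Sigma_b(\varepsilon)$ $$C_k^{\mathrm{var}}\Big(F_\varepsilon,\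 \partial(S_\sigma F)_\varepsilon\cap\partial\bigcup_{\sigma'\in\Sigma(\varepsilon)\setminus\{\sigma\}}(S_{\sigma'}F)_\varepsilon\Big)\le c_k\varepsilon^k.$$ *)

theory Defs
  imports "HOL-Analysis.Analysis" "HOL-Library.Disjoint_Sets"
begin

section \<open>Sets of positive reach and curvature measures\<close>

definition unp :: "'a::euclidean_space set \<Rightarrow> 'a set" where
  "unp A = {x. \<exists>!a. a \<in> A \<and> dist x a = infdist x A}"

definition reach_at :: "'a::euclidean_space set \<Rightarrow> 'a \<Rightarrow> ereal" where
  "reach_at A a = (SUP r\<in>{r. ball a r \<subseteq> unp A}. ereal r)"

definition reach :: "'a::euclidean_space set \<Rightarrow> ereal" where
  "reach A = (INF a\<in>A. reach_at A a)"

text \<open>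
  Federer's curvature measures are given by the local Steiner formula: if \<open>A\<close> has positive reach,
  there are unique (signed) Radon measures \<open>C\<^sub>0(A,\<cdot>), \<dots>, C\<^sub>d(A,\<cdot>)\<close> such that the formula below holds
  with \<open>c m = C\<^sub>m(A,Q)\<close> for all bounded Borel sets \<open>Q\<close> and all \<open>0 < r < reach A\<close>. On \<open>unp A\<close>,
  \<open>closest_point A\<close> is the metric projection onto \<open>A\<close>. For each \<open>Q\<close> the right-hand side is a
  polynomial in \<open>r\<close>, so its coefficients are already determined by all small \<open>r > 0\<close>. The clause
  \<open>c m = 0\<close> for \<open>m > d\<close> only fixes the irrelevant values of \<open>c\<close>.
\<close>

definition steiner_coeffs :: "'a::euclidean_space set \<Rightarrow> 'a set \<Rightarrow> (nat \<Rightarrow> real) \<Rightarrow> bool" where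
  "steiner_coeffs A Q c \<longleftrightarrow>
     (\<forall>m>DIM('a). c m = 0) \<and>
     (\<forall>\<^sub>F r in at_right 0.
        measure lebesgue {x \<in> unp A. infdist x A \<le> r \<and> closest_point A x \<in> Q} =
        (\<Sum>m\<le>DIM('a). r ^ (DIM('a) - m) * unit_ball_vol (real (DIM('a) - m)) * c m))"

text \<open>
  \<open>curvature_measure k A Q\<close> is \<open>C\<^sub>k(A,Q)\<close> for \<open>A\<close> of positive reach and \<open>Q\<close> a bounded Borel set; by
  Federer's theorem the \<open>else\<close> branch does not occur for such \<open>A\<close> and \<open>Q\<close>. It is not meant to be
  evaluated at unbounded \<open>Q\<close>.
\<close>

definition curvature_measure :: "nat \<Rightarrow> 'a::euclidean_space set \<Rightarrow> 'a set \<Rightarrow> real" where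
  "curvature_measure k A Q =
     (if \<exists>c. steiner_coeffs A Q c then (THE c. steiner_coeffs A Q c) k else 0)"

text \<open>The total variation of a signed measure on the Borel sets. Its value at a bounded \<open>Q\<close> only
  involves Borel subsets of \<open>Q\<close>.\<close>

definition variation :: "('a::topological_space set \<Rightarrow> real) \<Rightarrow> 'a set \<Rightarrow> ennreal" where
  "variation \<mu> Q =
     (SUP P\<in>{P. finite P \<and> P \<subseteq> sets borel \<and> partition_on Q P}. \<Sum>E\<in>P. ennreal \<bar>\<mu> E\<bar>)"

section \<open>Parallel sets\<close>

text \<open>The library sets \<open>infdist x {} = 0\<close>; the guard makes parallel sets of the empty set empty.\<close>

definition parallel_set :: "'a::euclidean_space set \<Rightarrow> real \<Rightarrow> 'a set" where
  "parallel_set K \<epsilon> = {x. K \<noteq> {} \<and> infdist x K \<le> \<epsilon>}"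

definition lipschitz_manifold :: "nat \<Rightarrow> 'a::euclidean_space set \<Rightarrow> bool" where
  "lipschitz_manifold m M \<longleftrightarrow>
     (\<forall>p\<in>M. \<exists>U V W f g L.
        p \<in> U \<and> openin (top_of_set M) U \<and>
        subspace (V :: 'a set) \<and> dim V = m \<and> openin (top_of_set V) W \<and>
        homeomorphism U W f g \<and> L-lipschitz_on U f \<and> L-lipschitz_on W g)"

definition regular_distance :: "'a::euclidean_space set \<Rightarrow> real \<Rightarrow> bool" where
  "regular_distance K \<epsilon> \<longleftrightarrow>
     \<epsilon> \<ge> 0 \<and> reach (closure (- parallel_set K \<epsilon>)) > 0 \<and>
     lipschitz_manifold (DIM('a) - 1) (frontier (parallel_set K \<epsilon>))"

text \<open>\<open>C\<^sub>k(K\<^sub>\<epsilon>,\<cdot>)\<close> for a compact set \<open>K\<close>, a regular distance \<open>\<epsilon>\<close> and \<open>k < d\<close>.\<close>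

definition parallel_curvature ::
    "nat \<Rightarrow> 'a::euclidean_space set \<Rightarrow> real \<Rightarrow> 'a set \<Rightarrow> real" where
  "parallel_curvature k K \<epsilon> Q =
     (-1) ^ (DIM('a) - 1 - k) * curvature_measure k (closure (- parallel_set K \<epsilon>)) Q"

definition parallel_curvature_var ::
    "nat \<Rightarrow> 'a::euclidean_space set \<Rightarrow> real \<Rightarrow> 'a set \<Rightarrow> ennreal" where
  "parallel_curvature_var k K \<epsilon> = variation (parallel_curvature k K \<epsilon>)"

section \<open>Self-similar sets\<close>

definition self_similar_set ::
    "nat \<Rightarrow> (nat \<Rightarrow> 'a::euclidean_space \<Rightarrow> 'a) \<Rightarrow> (nat \<Rightarrow> real) \<Rightarrow> 'a set \<Rightarrow> bool" where
  "self_similar_set N S r F \<longleftrightarrow>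
     (\<forall>i\<in>{1..N}. 0 < r i \<and> r i < 1 \<and> (\<forall>x y. dist (S i x) (S i y) = r i * dist x y)) \<and>
     compact F \<and> F \<noteq> {} \<and> F = (\<Union>i\<in>{1..N}. S i ` F)"

definition osc_set :: "nat \<Rightarrow> (nat \<Rightarrow> 'a::euclidean_space \<Rightarrow> 'a) \<Rightarrow> 'a set \<Rightarrow> bool" where
  "osc_set N S U \<longleftrightarrow>
     open U \<and> bounded U \<and> U \<noteq> {} \<and> (\<Union>i\<in>{1..N}. S i ` U) \<subseteq> U \<and>
     (\<forall>i\<in>{1..N}. \<forall>j\<in>{1..N}. i \<noteq> j \<longrightarrow> S i ` U \<inter> S j ` U = {})"

definition OSC :: "nat \<Rightarrow> (nat \<Rightarrow> 'a::euclidean_space \<Rightarrow> 'a) \<Rightarrow> bool" where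
  "OSC N S \<longleftrightarrow> (\<exists>U. osc_set N S U)"

definition sosc_set :: "nat \<Rightarrow> (nat \<Rightarrow> 'a::euclidean_space \<Rightarrow> 'a) \<Rightarrow> 'a set \<Rightarrow> 'a set \<Rightarrow> bool" where
  "sosc_set N S F U \<longleftrightarrow> osc_set N S U \<and> U \<inter> F \<noteq> {}"

definition RC :: "'a::euclidean_space set \<Rightarrow> bool" where
  "RC F \<longleftrightarrow> (AE \<epsilon> in lebesgue. 0 < \<epsilon> \<and> \<epsilon> < sqrt 2 * diameter F \<longrightarrow> regular_distance F \<epsilon>)"

definition word_ratio :: "(nat \<Rightarrow> real) \<Rightarrow> nat list \<Rightarrow> real" where
  "word_ratio r \<omega> = prod_list (map r \<omega>)"

definition word_map :: "(nat \<Rightarrow> 'a \<Rightarrow> 'a) \<Rightarrow> nat list \<Rightarrow> 'a \<Rightarrow> 'a" where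
  "word_map S \<omega> = foldr (\<circ>) (map S \<omega>) id"

definition words_at :: "nat \<Rightarrow> (nat \<Rightarrow> real) \<Rightarrow> real \<Rightarrow> real \<Rightarrow> nat list set" where
  "words_at N r R \<epsilon> =
     {\<omega> \<in> lists {1..N}. \<omega> \<noteq> [] \<and> R * word_ratio r \<omega> < \<epsilon> \<and> \<epsilon> \<le> R * word_ratio r (butlast \<omega>)}"

definition boundary_words ::
    "nat \<Rightarrow> (nat \<Rightarrow> 'a::euclidean_space \<Rightarrow> 'a) \<Rightarrow> (nat \<Rightarrow> real) \<Rightarrow> 'a set \<Rightarrow> real \<Rightarrow> 'a set \<Rightarrow> real
      \<Rightarrow> nat list set" where
  "boundary_words N S r F R U \<epsilon> =
     {\<omega> \<in> words_at N r R \<epsilon>.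
        parallel_set (word_map S \<omega> ` F) \<epsilon> \<inter> parallel_set (- (\<Union>i\<in>{1..N}. S i ` U)) \<epsilon> \<noteq> {}}"

definition CBC ::
    "nat \<Rightarrow> (nat \<Rightarrow> 'a::euclidean_space \<Rightarrow> 'a) \<Rightarrow> (nat \<Rightarrow> real) \<Rightarrow> 'a set \<Rightarrow> real \<Rightarrow> nat \<Rightarrow> 'a set
      \<Rightarrow> bool" where
  "CBC N S r F R k U \<longleftrightarrow>
     (\<exists>c::real. AE \<epsilon> in lebesgue. 0 < \<epsilon> \<and> \<epsilon> < R \<longrightarrow>
        (\<forall>\<sigma>\<in>boundary_words N S r F R U \<epsilon>.
           parallel_curvature_var k F \<epsilon>
             (frontier (parallel_set (word_map S \<sigma> ` F) \<epsilon>) \<inter>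
              frontier (\<Union>\<sigma>'\<in>words_at N r R \<epsilon> - {\<sigma>}. parallel_set (word_map S \<sigma>' ` F) \<epsilon>))
           \<le> ennreal (c * \<epsilon> ^ k)))"

end

theory Submission
  imports Defs
begin

text \<open>
  CBC for one open set \<open>O\<close> implies the same bound for all words in \<open>\<Sigma>(\<epsilon>)\<close>, not only for the
  boundary words; the latter condition does not mention \<open>O\<close>. Indeed, if \<open>\<sigma> = i\<tau>\<close> is not a boundary
  word, then \<open>F\<^sub>\<epsilon>\<close> coincides near \<open>(S\<^sub>\<sigma> F)\<^sub>\<epsilon>\<close> with \<open>(S\<^sub>i F)\<^sub>\<epsilon>\<close>, which is the image under \<open>S\<^sub>i\<close> of the parallel
  set of \<open>F\<close> at distance \<open>\<epsilon> / r\<^sub>i\<close>. Since curvature measures are local and scale with \<open>r\<^sub>i ^ k\<close>, the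
  bound for \<open>\<sigma>\<close> at \<open>\<epsilon>\<close> follows from the one for \<open>\<tau>\<close> at \<open>\<epsilon> / r\<^sub>i\<close>. Letters are removed until a boundary
  word is reached, or a single nonboundary letter, for which the set in question is empty. The
  exceptional distances lie in a countable union of scaled null sets.
\<close>

section \<open>Similarities and Lebesgue measure\<close>

text \<open>Every positive ratio is allowed, not only contractions, so that the class is closed
  under inverses. Several equalities below are proved as one estimate for all similarities and then
  reversed by applying it to \<open>inv f\<close>.\<close>

definition similarity :: "real \<Rightarrow> ('a::euclidean_space \<Rightarrow> 'a) \<Rightarrow> bool" where
  "similarity c f \<longleftrightarrow> 0 < c \<and> (\<forall>x y. dist (f x) (f y) = c * dist x y)"

lemma similarity_dist: "similarity c f \<Longrightarrow> dist (f x) (f y) = c * dist x y"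
  by (simp add: similarity_def)

lemma similarity_pos: "similarity c f \<Longrightarrow> 0 < c"
  by (simp add: similarity_def)

lemma similarity_inj:
  assumes "similarity c f"
  shows "inj f"
proof (rule injI)
  fix x y assume "f x = f y"
  then have "c * dist x y = 0"
    using similarity_dist[OF assms, of x y] by simp
  then show "x = y"
    using similarity_pos[OF assms] by simp
qed

text \<open>After subtracting \<open>f 0\<close> the map fixes the origin and scales distances,
  hence is linear. An injective linear map of a finite-dimensional space into itself is
  onto.\<close>

lemma similarity_bij:
  assumes "similarity c f"
  shows "bij f"
proof -
  define g where "g = (\<lambda>x. f x - f 0)"
  have dg: "dist (g x) (g y) = c * dist x y" for x y
    using similarity_dist[OF assms, of x y] by (simp add: g_def dist_norm)
  have "linear g"
    by (rule scaling_linear[where c = c]) (auto simp: dg, simp add: g_def)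
  moreover have "inj g"
    using similarity_inj[OF assms] by (simp add: g_def inj_on_def)
  ultimately have "surj g"
    by (rule linear_injective_imp_surjective) simp
  have "surj f"
  proof (rule surjI)
    fix y
    show "f (inv g (y - f 0)) = y"
      using surj_f_inv_f[OF \<open>surj g\<close>, of "y - f 0"] by (simp add: g_def)
  qed
  with similarity_inj[OF assms] show ?thesis
    by (simp add: bij_def)
qed

lemma similarity_inv:
  assumes "similarity c f"
  shows "similarity (1 / c) (inv f)"
proof -
  have "dist (inv f x) (inv f y) = 1 / c * dist x y" for x y
    using similarity_dist[OF assms, of "inv f x" "inv f y"] similarity_pos[OF assms]
    by (simp add: surj_f_inv_f bij_is_surj[OF similarity_bij[OF assms]])
  then show ?thesis
    using similarity_pos[OF assms] by (simp add: similarity_def)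
qed

lemma similarity_inv_image:
  "similarity c f \<Longrightarrow> inv f ` f ` A = A"
  by (simp add: similarity_inj)

lemma similarity_continuous: "similarity c f \<Longrightarrow> continuous_on A f"
  by (rule lipschitz_on_continuous_on[of c]) (auto intro: lipschitz_onI simp: similarity_def)

lemma similarity_closure_image:
  assumes "similarity c f"
  shows "closure (f ` A) = f ` closure A"
proof
  show "f ` closure A \<subseteq> closure (f ` A)"
    by (intro image_closure_subset similarity_continuous[OF assms] closure_subset closed_closure)
  have "inv f ` closure (f ` A) \<subseteq> closure (inv f ` f ` A)"
    by (intro image_closure_subset similarity_continuous[OF similarity_inv[OF assms]]
        closure_subset closed_closure)
  then show "closure (f ` A) \<subseteq> f ` closure A"
    using assms by (metis image_mono image_inv_f_f image_f_inv_f bij_is_surj similarity_bij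
        similarity_inv_image)
qed

lemma similarity_frontier_image:
  assumes "similarity c f"
  shows "frontier (f ` A) = f ` frontier A"
  using assms
  by (simp add: frontier_closures similarity_closure_image image_Int similarity_inj
      bij_image_Compl_eq[OF similarity_bij, symmetric])

lemma similarity_ball_image:
  assumes "similarity c f"
  shows "f ` ball x \<rho> = ball (f x) (c * \<rho>)"
proof (intro subset_antisym subsetI)
  fix y assume "y \<in> ball (f x) (c * \<rho>)"
  moreover obtain z where "y = f z"
    using bij_is_surj[OF similarity_bij[OF assms]] by auto
  ultimately show "y \<in> f ` ball x \<rho>"
    using similarity_pos[OF assms] by (auto simp: similarity_dist[OF assms])
qed (use similarity_pos[OF assms] in \<open>auto simp: similarity_dist[OF assms]\<close>)

lemma similarity_open_image:
  assumes "similarity c f" "open A"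
  shows "open (f ` A)"
  using assms bij_image_Compl_eq[OF similarity_bij[OF assms(1)], of A]
    similarity_closure_image[OF assms(1), of "- A"]
  by (metis closed_Compl closed_closure closure_closed open_closed)

section \<open>Null sets and volume under similarities\<close>

lemma similarity_negligible_image:
  assumes "similarity c f" "negligible A"
  shows "negligible (f ` A)"
proof (rule negligible_locally_Lipschitz_image)
  fix x
  show "\<exists>T B. open T \<and> x \<in> T \<and> (\<forall>y\<in>A \<inter> T. norm (f y - f x) \<le> B * norm (y - x))"
    using similarity_dist[OF assms(1)] by (intro exI[of _ UNIV] exI[of _ c]) (simp add: dist_norm)
qed (use assms in auto)

lemma similarity_lebesgue_sets:
  assumes "similarity c f" "A \<in> sets lebesgue"
  shows "f ` A \<in> sets lebesgue"
  using assms(2) similarity_continuous[OF assms(1)]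
  by (rule sets_lebesgue_continuous_image) (auto intro: similarity_negligible_image[OF assms(1)])

text \<open>By Vitali's theorem an open set is, up to a null set, a disjoint union of balls, and balls scale
  correctly. This avoids determinants, which the library has only for \<open>real^'n\<close>.\<close>

lemma similarity_emeasure_open_le:
  fixes f :: "'a::euclidean_space \<Rightarrow> 'a"
  assumes f: "similarity c f" and "open U"
  shows "emeasure lebesgue (f ` U) \<le> ennreal (c ^ DIM('a)) * emeasure lebesgue U"
proof -
  let ?K = "{(x, \<rho>). 0 < \<rho> \<and> ball x \<rho> \<subseteq> U}"
  obtain C where C: "countable C" "C \<subseteq> ?K"
    and dis: "pairwise (\<lambda>i j. disjnt (ball (fst i) (snd i)) (ball (fst j) (snd j))) C"
    and neg: "negligible (U - (\<Union>i\<in>C. ball (fst i) (snd i)))"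
  proof (rule Vitali_covering_theorem_balls[of U ?K fst snd])
    fix x d assume "x \<in> U" "0 < (d::real)"
    then obtain e where "e > 0" "ball x e \<subseteq> U"
      using \<open>open U\<close> openE by blast
    \<comment> \<open>The radius must keep the ball inside \<open>U\<close> and also stay below
      \<open>d\<close>; \<open>d / 2\<close> makes the second inequality strict.\<close>
    then show "\<exists>i. i \<in> ?K \<and> x \<in> ball (fst i) (snd i) \<and> snd i < d"
      using \<open>0 < d\<close> subset_ball[of "min e (d / 2)" e x] by (intro exI[of _ "(x, min e (d / 2))"]) auto
  qed
  let ?B = "\<lambda>i. ball (fst i) (snd i)" and ?B' = "\<lambda>i. ball (f (fst i)) (c * snd i)"
  have im: "f ` ?B i = ?B' i" for i
    by (rule similarity_ball_image[OF f])
  have disf: "disjoint_family_on ?B C"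
    using dis by (auto simp: disjoint_family_on_def pairwise_def disjnt_def)
  have disf': "disjoint_family_on ?B' C"
    using disf unfolding disjoint_family_on_def im[symmetric]
    by (metis image_Int[OF similarity_inj[OF f]] image_empty)
  have ball: "emeasure lebesgue (?B' i) = ennreal (c ^ DIM('a)) * emeasure lebesgue (?B i)"
    if "i \<in> C" for i
  proof -
    have "snd i > 0" using that C by auto
    then show ?thesis
      using similarity_pos[OF f]
      by (simp add: emeasure_ball power_mult_distrib ennreal_mult'[symmetric] mult_ac)
  qed
  have sub: "f ` U \<subseteq> (\<Union>i\<in>C. ?B' i) \<union> f ` (U - (\<Union>i\<in>C. ?B i))"
    unfolding im[symmetric] by blast
  have null: "f ` (U - (\<Union>i\<in>C. ?B i)) \<in> null_sets lebesgue"
    using similarity_negligible_image[OF f neg] by (simp add: negligible_iff_null_sets)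
  have bm: "(\<Union>i\<in>C. ?B' i) \<in> sets lebesgue"
    by (intro sets_completionI_sets) (auto intro: borel_open)
  have "emeasure lebesgue (f ` U) \<le> emeasure lebesgue ((\<Union>i\<in>C. ?B' i) \<union> f ` (U - (\<Union>i\<in>C. ?B i)))"
    using sets.Un[OF bm null_setsD2[OF null]] by (rule emeasure_mono[OF sub])
  also have "\<dots> = emeasure lebesgue (\<Union>i\<in>C. ?B' i)"
    by (rule emeasure_Un_null_set[OF bm null])
  also have "\<dots> = (\<integral>\<^sup>+i. emeasure lebesgue (?B' i) \<partial>count_space C)"
    using C disf' by (intro emeasure_UN_countable) (auto simp: sets_completionI_sets)
  also have "\<dots> = (\<integral>\<^sup>+i. ennreal (c ^ DIM('a)) * emeasure lebesgue (?B i) \<partial>count_space C)"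
    by (intro nn_integral_cong) (use ball in simp)
  also have "\<dots> = ennreal (c ^ DIM('a)) * (\<integral>\<^sup>+i. emeasure lebesgue (?B i) \<partial>count_space C)"
    by (intro nn_integral_cmult) simp
  also have "(\<integral>\<^sup>+i. emeasure lebesgue (?B i) \<partial>count_space C) = emeasure lebesgue (\<Union>i\<in>C. ?B i)"
    using C disf by (intro emeasure_UN_countable[symmetric]) (auto simp: sets_completionI_sets)
  also have "\<dots> \<le> emeasure lebesgue U"
  proof (rule emeasure_mono)
    show "(\<Union>i\<in>C. ?B i) \<subseteq> U"
      using C(2) by fastforce
  qed (use \<open>open U\<close> in \<open>simp add: sets_completionI_sets\<close>)
  finally show ?thesis
    by (simp add: mult_left_mono)
qed

text \<open>Outer regularity reduces the bound to open sets. The map multiplies the measure of the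
  excess \<open>T - A\<close> by at most \<open>c ^ DIM('a)\<close>, so an excess below
  \<open>e / c ^ DIM('a)\<close> costs at most \<open>e\<close>.\<close>

lemma similarity_emeasure_le:
  fixes f :: "'a::euclidean_space \<Rightarrow> 'a"
  assumes f: "similarity c f" and A: "A \<in> sets lebesgue"
  shows "emeasure lebesgue (f ` A) \<le> ennreal (c ^ DIM('a)) * emeasure lebesgue A"
proof (rule ennreal_le_epsilon)
  fix e :: real assume "0 < e"
  define e' where "e' = e / c ^ DIM('a)"
  have cd: "c ^ DIM('a) > 0"
    using similarity_pos[OF f] by simp
  have "e' > 0"
    using \<open>0 < e\<close> cd by (simp add: e'_def)
  then obtain T where T: "open T" "A \<subseteq> T" "T - A \<in> lmeasurable"
    "emeasure lebesgue (T - A) < ennreal e'"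
    using sets_lebesgue_outer_open[OF A] by blast
  have "emeasure lebesgue (f ` A) \<le> emeasure lebesgue (f ` T)"
    using T similarity_open_image[OF f T(1)]
    by (intro emeasure_mono) (auto simp: sets_completionI_sets)
  also have "\<dots> \<le> ennreal (c ^ DIM('a)) * emeasure lebesgue T"
    by (rule similarity_emeasure_open_le[OF f T(1)])
  also have "emeasure lebesgue T = emeasure lebesgue A + emeasure lebesgue (T - A)"
    using A T by (subst plus_emeasure) (auto simp: fmeasurable_def Un_absorb1)
  also have "\<dots> \<le> emeasure lebesgue A + ennreal e'"
    using T by (intro add_left_mono) simp
  also have "ennreal (c ^ DIM('a)) * (emeasure lebesgue A + ennreal e') =
      ennreal (c ^ DIM('a)) * emeasure lebesgue A + ennreal e"
    using cd similarity_pos[OF f] \<open>e' > 0\<close> by (simp add: distrib_left ennreal_mult'[symmetric] e'_def)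
  finally show "emeasure lebesgue (f ` A) \<le> ennreal (c ^ DIM('a)) * emeasure lebesgue A + ennreal e"
    using cd by (simp add: mult_left_mono)
qed

text \<open>The reverse inequality is the upper bound for \<open>inv f\<close>, multiplied by
  \<open>c ^ DIM('a)\<close>. If \<open>A\<close> is not measurable, neither is its image, and
  \<open>measure\<close> is 0 on both sides by convention.\<close>

lemma similarity_measure:
  fixes f :: "'a::euclidean_space \<Rightarrow> 'a"
  assumes f: "similarity c f"
  shows "measure lebesgue (f ` A) = c ^ DIM('a) * measure lebesgue A"
proof (cases "A \<in> sets lebesgue")
  case True
  have cd: "c ^ DIM('a) > 0"
    using similarity_pos[OF f] by simp
  have "emeasure lebesgue A \<le> ennreal ((1 / c) ^ DIM('a)) * emeasure lebesgue (f ` A)"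
    using similarity_emeasure_le[OF similarity_inv[OF f] similarity_lebesgue_sets[OF f True]]
    by (simp add: similarity_inv_image[OF f])
  then have "ennreal (c ^ DIM('a)) * emeasure lebesgue A
      \<le> ennreal (c ^ DIM('a)) * (ennreal ((1 / c) ^ DIM('a)) * emeasure lebesgue (f ` A))"
    by (rule mult_left_mono) simp
  also have "\<dots> = emeasure lebesgue (f ` A)"
    using cd similarity_pos[OF f]
    by (simp add: mult.assoc[symmetric] ennreal_mult'[symmetric] power_one_over)
  finally have "emeasure lebesgue (f ` A) = ennreal (c ^ DIM('a)) * emeasure lebesgue A"
    using similarity_emeasure_le[OF f True] by (intro antisym)
  then show ?thesis
    using cd by (simp add: measure_def enn2real_mult)
next
  case False
  then have "f ` A \<notin> sets lebesgue"
    using similarity_lebesgue_sets[OF similarity_inv[OF f], of "f ` A"]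
    by (auto simp: similarity_inv_image[OF f])
  with False show ?thesis
    by (simp add: measure_notin_sets)
qed

section \<open>Locality and scaling of curvature measures\<close>

lemma unp_closest_point_iff:
  assumes "closed A" "A \<noteq> {}"
  shows "x \<in> unp A \<and> closest_point A x = p \<longleftrightarrow> p \<in> A \<and> (\<forall>a\<in>A. a \<noteq> p \<longrightarrow> dist x p < dist x a)"
    (is "?L \<longleftrightarrow> ?R")
proof
  have inf: "infdist x A = dist x (closest_point A x)"
    using setdist_closest_point[OF assms] by (simp add: infdist_eq_setdist)
  {
    assume ?L
    then have ex: "\<exists>!a. a \<in> A \<and> dist x a = infdist x A"
      by (simp add: unp_def)
    obtain b where u: "\<forall>a. a \<in> A \<and> dist x a = infdist x A \<longrightarrow> a = b"
      by (rule ex1E[OF ex]) (erule that)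
    have p: "closest_point A x = p"
      using \<open>?L\<close> ..
    have "p \<in> A"
      using closest_point_exists(1)[OF assms, of x] p by simp
    moreover have "dist x p < dist x a" if "a \<in> A" "a \<noteq> p" for a
    proof -
      have "dist x a \<noteq> dist x p"
        using u[rule_format, of a] u[rule_format, of p] that inf p \<open>p \<in> A\<close> by auto
      then show ?thesis
        using infdist_le[OF that(1), of x] inf p by simp
    qed
    ultimately show ?R by blast
  }
  assume R: ?R
  have cp: "closest_point A x = p"
  proof (rule ccontr)
    assume "closest_point A x \<noteq> p"
    then have "dist x p < dist x (closest_point A x)"
      using R closest_point_exists(1)[OF assms, of x] by simp
    then show False
      using closest_point_exists(2)[OF assms, of x] R by (simp add: leD)
  qed
  moreover have "x \<in> unp A"
    unfolding unp_def inf cp mem_Collect_eq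
  proof (rule ex1I)
    show "p \<in> A \<and> dist x p = dist x p"
      using R by simp
    fix a assume "a \<in> A \<and> dist x a = dist x p"
    with R show "a = p"
      by force
  qed
  ultimately show ?L
    by simp
qed

text \<open>For closed nonempty \<open>A\<close> this is the set in the local Steiner formula, rewritten without
  \<open>infdist\<close> and \<open>closest_point\<close> so that locality and scaling can be read off.\<close>

definition steiner_set :: "'a::euclidean_space set \<Rightarrow> 'a set \<Rightarrow> real \<Rightarrow> 'a set" where
  "steiner_set A Q \<rho> =
     {x. \<exists>p\<in>Q \<inter> A. dist x p \<le> \<rho> \<and> (\<forall>a\<in>A. a \<noteq> p \<longrightarrow> dist x p < dist x a)}"

lemma steiner_set_eq:
  assumes "closed A" "A \<noteq> {}"
  shows "{x \<in> unp A. infdist x A \<le> \<rho> \<and> closest_point A x \<in> Q} = steiner_set A Q \<rho>"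
proof -
  have inf: "infdist x A = dist x (closest_point A x)" for x
    using setdist_closest_point[OF assms] by (simp add: infdist_eq_setdist)
  show ?thesis
  proof (intro set_eqI iffI)
    fix x assume "x \<in> {x \<in> unp A. infdist x A \<le> \<rho> \<and> closest_point A x \<in> Q}"
    then have x: "x \<in> unp A" "dist x (closest_point A x) \<le> \<rho>" "closest_point A x \<in> Q"
      by (auto simp: inf)
    then show "x \<in> steiner_set A Q \<rho>"
      using unp_closest_point_iff[OF assms, of x "closest_point A x"] unfolding steiner_set_def
      by (intro CollectI bexI[of _ "closest_point A x"]) auto
  next
    fix x assume "x \<in> steiner_set A Q \<rho>"
    then obtain p where p: "p \<in> Q" "dist x p \<le> \<rho>"
        "p \<in> A \<and> (\<forall>a\<in>A. a \<noteq> p \<longrightarrow> dist x p < dist x a)"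
      unfolding steiner_set_def by blast
    have "x \<in> unp A" "closest_point A x = p"
      using p(3) unfolding unp_closest_point_iff[OF assms, symmetric] by simp_all
    with p show "x \<in> {x \<in> unp A. infdist x A \<le> \<rho> \<and> closest_point A x \<in> Q}"
      by (simp add: inf)
  qed
qed

lemma steiner_coeffs_iff:
  fixes A :: "'a::euclidean_space set"
  assumes "closed A" "A \<noteq> {}"
  shows "steiner_coeffs A Q w \<longleftrightarrow>
     (\<forall>m>DIM('a). w m = 0) \<and>
     (\<forall>\<^sub>F \<rho> in at_right 0. measure lebesgue (steiner_set A Q \<rho>) =
        (\<Sum>m\<le>DIM('a). \<rho> ^ (DIM('a) - m) * unit_ball_vol (real (DIM('a) - m)) * w m))"
  unfolding steiner_coeffs_def steiner_set_eq[OF assms] ..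

lemma steiner_set_similarity_subset:
  assumes f: "similarity c f"
  shows "f ` steiner_set A Q \<rho> \<subseteq> steiner_set (f ` A) (f ` Q) (c * \<rho>)"
proof
  fix y assume "y \<in> f ` steiner_set A Q \<rho>"
  then obtain x p where x: "y = f x" "p \<in> Q" "p \<in> A" "dist x p \<le> \<rho>"
    and lt: "\<And>a. a \<in> A \<Longrightarrow> a \<noteq> p \<Longrightarrow> dist x p < dist x a"
    unfolding steiner_set_def by auto
  have "dist y (f p) \<le> c * \<rho>"
    using x similarity_pos[OF f] by (simp add: similarity_dist[OF f])
  moreover have "dist y (f p) < dist y (f a)" if "a \<in> A" "f a \<noteq> f p" for a
    using lt[of a] that similarity_pos[OF f] x(1) by (auto simp: similarity_dist[OF f])
  ultimately show "y \<in> steiner_set (f ` A) (f ` Q) (c * \<rho>)"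
    using x unfolding steiner_set_def by blast
qed

lemma steiner_set_similarity:
  assumes f: "similarity c f"
  shows "steiner_set (f ` A) (f ` Q) (c * \<rho>) = f ` steiner_set A Q \<rho>"
proof
  have "inv f ` steiner_set (f ` A) (f ` Q) (c * \<rho>) \<subseteq> steiner_set A Q \<rho>"
    using steiner_set_similarity_subset[OF similarity_inv[OF f], of "f ` A" "f ` Q" "c * \<rho>"]
      similarity_pos[OF f]
    by (simp add: similarity_inv_image[OF f])
  then show "steiner_set (f ` A) (f ` Q) (c * \<rho>) \<subseteq> f ` steiner_set A Q \<rho>"
    using image_mono[of _ _ f] image_f_inv_f[OF bij_is_surj[OF similarity_bij[OF f]]] by metis
qed (rule steiner_set_similarity_subset[OF f])

text \<open>The difference of the two Steiner polynomials vanishes on an interval to the right of 0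
  and therefore has infinitely many roots. Its coefficients are zero, and the positive unit ball
  volumes can be divided out.\<close>

lemma steiner_coeffs_unique:
  fixes A :: "'a::euclidean_space set"
  assumes v: "steiner_coeffs A Q v" and w: "steiner_coeffs A Q w"
  shows "v = w"
proof -
  let ?d = "DIM('a)"
  \<comment> \<open>Indexed by the exponent of \<rho>: the coefficient with index \<open>m\<close>
    belongs to the power \<open>DIM('a) - m\<close>.\<close>
  define b where "b = (\<lambda>i. unit_ball_vol (real i) * (v (?d - i) - w (?d - i)))"
  have "\<forall>\<^sub>F \<rho> in at_right 0. (\<Sum>i\<le>?d. b i * \<rho> ^ i) = 0"
    using v[unfolded steiner_coeffs_def, THEN conjunct2]
      w[unfolded steiner_coeffs_def, THEN conjunct2]
  proof eventually_elim
    case (elim \<rho>)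
    have "(\<Sum>i\<le>?d. b i * \<rho> ^ i) = (\<Sum>m\<le>?d. b (?d - m) * \<rho> ^ (?d - m))"
      by (rule sum.reindex_bij_witness[of _ "\<lambda>m. ?d - m" "\<lambda>m. ?d - m"]) auto
    also have "\<dots> = (\<Sum>m\<le>?d. \<rho> ^ (?d - m) * unit_ball_vol (real (?d - m)) * v m)
        - (\<Sum>m\<le>?d. \<rho> ^ (?d - m) * unit_ball_vol (real (?d - m)) * w m)"
      unfolding sum_subtractf[symmetric] b_def by (rule sum.cong) (auto simp: algebra_simps)
    finally show ?case
      using elim by simp
  qed
  then obtain e where "e > 0" and e: "\<And>\<rho>. 0 < \<rho> \<Longrightarrow> \<rho> < e \<Longrightarrow> (\<Sum>i\<le>?d. b i * \<rho> ^ i) = 0"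
    unfolding eventually_at_right_field by auto
  then have "{0<..<e} \<subseteq> {\<rho>. (\<Sum>i\<le>?d. b i * \<rho> ^ i) = 0}"
    by auto
  then have "infinite {\<rho>. (\<Sum>i\<le>?d. b i * \<rho> ^ i) = 0}"
    using \<open>e > 0\<close> infinite_Ioo finite_subset by blast
  then have b0: "b i = 0" if "i \<le> ?d" for i
    using that polyfun_finite_roots[of b ?d] by blast
  show ?thesis
  proof
    fix m
    show "v m = w m"
    proof (cases "m \<le> ?d")
      case True
      then show ?thesis
        using b0[of "?d - m"] unit_ball_vol_pos[of "real (?d - m)"]
        by (simp add: b_def order_less_imp_not_eq2 del: of_nat_diff)
    next
      case False
      then show ?thesis
        using v w by (simp add: steiner_coeffs_def)
    qed
  qed
qed

lemma curvature_measure_eqI: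
  assumes "steiner_coeffs A Q w"
  shows "curvature_measure k A Q = w k"
proof -
  have "(THE c. steiner_coeffs A Q c) = w"
    using assms steiner_coeffs_unique by (intro the_equality) auto
  with assms show ?thesis
    by (auto simp: curvature_measure_def)
qed

text \<open>The Steiner set of the image at distance \<rho> is the image of the one at
  \<open>\<rho> / c\<close>. Its volume gains the factor \<open>c ^ DIM('a)\<close>, and the powers
  of \<open>\<rho> / c\<close> take back \<open>c ^ (DIM('a) - m)\<close>, which leaves
  \<open>c ^ m\<close>.\<close>

lemma steiner_coeffs_similarity:
  fixes A :: "'a::euclidean_space set"
  assumes f: "similarity c f" and A: "closed A" "A \<noteq> {}" and w: "steiner_coeffs A Q w"
  shows "steiner_coeffs (f ` A) (f ` Q) (\<lambda>m. c ^ m * w m)"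
proof -
  let ?d = "DIM('a)"
  have c: "c > 0" by (rule similarity_pos[OF f])
  have A': "closed (f ` A)" "f ` A \<noteq> {}"
    using A similarity_closure_image[OF f, of A] by (auto simp: closure_eq[symmetric])
  obtain e where "e > 0" and e: "\<And>\<rho>. 0 < \<rho> \<Longrightarrow> \<rho> < e \<Longrightarrow> measure lebesgue (steiner_set A Q \<rho>) =
        (\<Sum>m\<le>?d. \<rho> ^ (?d - m) * unit_ball_vol (real (?d - m)) * w m)"
    using w unfolding steiner_coeffs_iff[OF A] eventually_at_right_field by auto
  \<comment> \<open>The bound \<open>c * e\<close> ensures \<open>\<rho> / c < e\<close>, where the
    expansion for \<open>A\<close> is valid.\<close>
  have "measure lebesgue (steiner_set (f ` A) (f ` Q) \<rho>) =
        (\<Sum>m\<le>?d. \<rho> ^ (?d - m) * unit_ball_vol (real (?d - m)) * (c ^ m * w m))"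
    if "0 < \<rho>" "\<rho> < c * e" for \<rho>
  proof -
    have "measure lebesgue (steiner_set (f ` A) (f ` Q) \<rho>) =
        measure lebesgue (f ` steiner_set A Q (\<rho> / c))"
      using steiner_set_similarity[OF f, of A Q "\<rho> / c"] c by simp
    also have "\<dots> = c ^ ?d * measure lebesgue (steiner_set A Q (\<rho> / c))"
      by (rule similarity_measure[OF f])
    also have "measure lebesgue (steiner_set A Q (\<rho> / c)) =
        (\<Sum>m\<le>?d. (\<rho> / c) ^ (?d - m) * unit_ball_vol (real (?d - m)) * w m)"
      using that c by (intro e) (auto simp: field_simps)
    also have "c ^ ?d * \<dots> = (\<Sum>m\<le>?d. \<rho> ^ (?d - m) * unit_ball_vol (real (?d - m)) * (c ^ m * w m))"
      unfolding sum_distrib_left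
    proof (rule sum.cong)
      fix m assume "m \<in> {..?d}"
      then have "c ^ ?d = c ^ (?d - m) * c ^ m"
        by (simp flip: power_add)
      then show "c ^ ?d * ((\<rho> / c) ^ (?d - m) * unit_ball_vol (real (?d - m)) * w m) =
          \<rho> ^ (?d - m) * unit_ball_vol (real (?d - m)) * (c ^ m * w m)"
        using c by (simp add: power_divide)
    qed simp
    finally show ?thesis .
  qed
  then have "\<forall>\<^sub>F \<rho> in at_right 0. measure lebesgue (steiner_set (f ` A) (f ` Q) \<rho>) =
        (\<Sum>m\<le>?d. \<rho> ^ (?d - m) * unit_ball_vol (real (?d - m)) * (c ^ m * w m))"
    unfolding eventually_at_right_field using \<open>e > 0\<close> c by (intro exI[of _ "c * e"]) auto
  with w show ?thesis
    unfolding steiner_coeffs_iff[OF A] steiner_coeffs_iff[OF A'] by auto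
qed

text \<open>If \<open>A\<close> and \<open>Q\<close> have no Steiner coefficients, then neither have
  their images, since \<open>inv f\<close> would carry the coefficients back. Both sides are then
  the default value 0.\<close>

lemma curvature_measure_similarity:
  assumes f: "similarity c f" and A: "closed A" "A \<noteq> {}"
  shows "curvature_measure k (f ` A) (f ` Q) = c ^ k * curvature_measure k A Q"
proof (cases "\<exists>w. steiner_coeffs A Q w")
  case True
  then obtain w where "steiner_coeffs A Q w" ..
  then show ?thesis
    using curvature_measure_eqI[OF steiner_coeffs_similarity[OF f A]] curvature_measure_eqI
    by metis
next
  case False
  have A': "closed (f ` A)" "f ` A \<noteq> {}"
    using A similarity_closure_image[OF f, of A] by (auto simp: closure_eq[symmetric])
  have "\<nexists>w. steiner_coeffs (f ` A) (f ` Q) w"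
    using False steiner_coeffs_similarity[OF similarity_inv[OF f] A', of "f ` Q"]
    by (auto simp: similarity_inv_image[OF f])
  with False show ?thesis
    by (simp add: curvature_measure_def)
qed

text \<open>A competitor that is at least as close to \<open>x\<close> as \<open>p\<close> lies
  within \<open>2 * \<rho>\<close> of \<open>p\<close>, hence in \<open>W\<close>, where the two
  sets agree.\<close>

lemma steiner_set_local_subset:
  assumes W: "\<And>p y. p \<in> Q \<Longrightarrow> dist y p \<le> 2 * \<rho> \<Longrightarrow> y \<in> W" and eq: "A \<inter> W = B \<inter> W"
  shows "steiner_set A Q \<rho> \<subseteq> steiner_set B Q \<rho>"
proof
  fix x assume "x \<in> steiner_set A Q \<rho>"
  then obtain p where p: "p \<in> Q" "p \<in> A" "dist x p \<le> \<rho>"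
    and lt: "\<And>a. a \<in> A \<Longrightarrow> a \<noteq> p \<Longrightarrow> dist x p < dist x a"
    unfolding steiner_set_def by auto
  have "0 \<le> \<rho>"
    using p(3) zero_le_dist[of x p] by linarith
  then have "p \<in> B"
    using p W[of p p] eq by auto
  moreover have "dist x p < dist x b" if "b \<in> B" "b \<noteq> p" for b
  proof (rule ccontr)
    assume "\<not> dist x p < dist x b"
    then have "dist b p \<le> 2 * \<rho>"
      using dist_triangle[of b p x] p(3) by (simp add: dist_commute)
    then have "b \<in> A"
      using W[OF p(1)] eq that by blast
    then show False
      using lt that \<open>\<not> dist x p < dist x b\<close> by blast
  qed
  ultimately show "x \<in> steiner_set B Q \<rho>"
    using p unfolding steiner_set_def by blast
qed

text \<open>The compact set \<open>Q\<close> has a positive distance from the complement of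
  \<open>W\<close>, so the Steiner sets of \<open>A\<close> and \<open>B\<close> coincide for all
  small \<rho>. As \<open>steiner_coeffs\<close> looks only at small \<rho>, the two predicates are
  equal, whether or not coefficients exist.\<close>

lemma curvature_measure_local:
  assumes A: "closed A" "A \<noteq> {}" and B: "closed B" "B \<noteq> {}"
    and Q: "compact Q" "Q \<subseteq> W" and W: "open W" and eq: "A \<inter> W = B \<inter> W" and "E \<subseteq> Q"
  shows "curvature_measure k A E = curvature_measure k B E"
proof -
  obtain e where "e > 0" and e: "\<And>p y. p \<in> E \<Longrightarrow> dist y p \<le> e \<Longrightarrow> y \<in> W"
  proof (cases "Q = {}")
    case True
    then show ?thesis
      using that[of 1] \<open>E \<subseteq> Q\<close> by auto
  next
    case False
    then obtain e where e: "e > 0" "{y. infdist y Q \<le> e} \<subseteq> W"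
      using compact_in_open_separated Q W by blast
    then show ?thesis
      using that[of e] \<open>E \<subseteq> Q\<close> infdist_le2 by blast
  qed
  \<comment> \<open>Half of \<open>e\<close>, because locality concerns the points within
    \<open>2 * \<rho>\<close> of \<open>E\<close>.\<close>
  have "steiner_set A E \<rho> = steiner_set B E \<rho>" if "\<rho> < e / 2" for \<rho>
    using that eq by (intro subset_antisym; intro steiner_set_local_subset[of _ _ W]) (auto intro: e)
  then have "\<forall>\<^sub>F \<rho> in at_right 0. steiner_set A E \<rho> = steiner_set B E \<rho>"
    unfolding eventually_at_right_field using \<open>e > 0\<close> by (intro exI[of _ "e / 2"]) auto
  then have "steiner_coeffs A E w = steiner_coeffs B E w" for w
    unfolding steiner_coeffs_iff[OF A] steiner_coeffs_iff[OF B]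
    by (intro conj_cong refl eventually_cong[OF \<open>eventually _ _\<close>]) simp
  then have "steiner_coeffs A E = steiner_coeffs B E"
    by (rule ext)
  then show ?thesis
    by (simp add: curvature_measure_def)
qed

text \<open>A Borel partition of the image pulls back along the continuous bijection
  \<open>f\<close> to a Borel partition of \<open>Q\<close>, and its sum differs only by the factor
  \<open>b\<close>.\<close>

lemma variation_similarity_le:
  assumes f: "similarity c f" and b: "0 \<le> b"
    and eq: "\<And>E. E \<subseteq> Q \<Longrightarrow> \<nu> (f ` E) = b * \<mu> E"
  shows "variation \<nu> (f ` Q) \<le> ennreal b * variation \<mu> Q"
  unfolding variation_def[of \<nu>]
proof (rule SUP_least)
  fix P assume "P \<in> {P. finite P \<and> P \<subseteq> sets borel \<and> partition_on (f ` Q) P}"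
  then have P: "finite P" "P \<subseteq> sets borel" "partition_on (f ` Q) P"
    by simp_all
  let ?P = "(\<lambda>E. f -` E) ` P"
  have surj: "f ` (f -` E) = E" for E
    using bij_is_surj[OF similarity_bij[OF f]] by (rule surj_image_vimage_eq)
  have inj: "inj_on (\<lambda>E. f -` E) P"
    by (rule inj_on_inverseI[where g = "(`) f"]) (rule surj)
  have sub: "f -` E \<subseteq> Q" if "E \<in> P" for E
  proof -
    have "E \<subseteq> f ` Q"
      using that partition_onD1[OF P(3)] by blast
    then show ?thesis
      using inj_image_mem_iff[OF similarity_inj[OF f]] by blast
  qed
  have "partition_on Q ?P"
  proof (rule partition_onI)
    have "\<Union> ?P = f -` \<Union> P"
      by blast
    also have "\<dots> = Q"
      unfolding partition_onD1[OF P(3), symmetric]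
      by (rule inj_vimage_image_eq[OF similarity_inj[OF f]])
    finally show "\<Union> ?P = Q" .
    show "disjnt p p'" if pp': "p \<in> ?P" "p' \<in> ?P" "p \<noteq> p'" for p p'
    proof -
      obtain E E' where "E \<in> P" "E' \<in> P" and [simp]: "p = f -` E" "p' = f -` E'"
        using pp' by blast
      then have "E \<inter> E' = {}"
        using partition_onD2[OF P(3)] pp'(3) by (auto dest: disjointD)
      then show ?thesis
        by (auto simp: disjnt_def)
    qed
    show "{} \<notin> ?P"
    proof
      assume "{} \<in> ?P"
      then obtain E where "E \<in> P" "f -` E = {}"
        by (elim imageE) simp
      then show False
        using partition_onD3[OF P(3)] surj[of E] by simp
    qed
  qed
  moreover have "?P \<subseteq> sets borel"
  proof (rule image_subsetI)
    fix E assume "E \<in> P"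
    then have "f -` E \<inter> space borel \<in> sets borel"
      using P(2)
      by (intro measurable_sets[OF borel_measurable_continuous_onI[OF similarity_continuous[OF f]]])
        auto
    then show "f -` E \<in> sets borel" by simp
  qed
  ultimately have "?P \<in> {P. finite P \<and> P \<subseteq> sets borel \<and> partition_on Q P}"
    using P(1) finite_imageI by blast
  then have "(\<Sum>E\<in>?P. ennreal \<bar>\<mu> E\<bar>) \<le> variation \<mu> Q"
    unfolding variation_def by (rule SUP_upper)
  then have "ennreal b * (\<Sum>E\<in>?P. ennreal \<bar>\<mu> E\<bar>) \<le> ennreal b * variation \<mu> Q"
    by (rule mult_left_mono) simp
  also have "ennreal b * (\<Sum>E\<in>?P. ennreal \<bar>\<mu> E\<bar>) = (\<Sum>E\<in>P. ennreal \<bar>\<nu> E\<bar>)"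
    unfolding sum_distrib_left sum.reindex[OF inj] comp_def
  proof (rule sum.cong)
    fix E assume "E \<in> P"
    then have "\<nu> E = b * \<mu> (f -` E)"
      using eq[OF sub, of E] unfolding surj by simp
    then show "ennreal b * ennreal \<bar>\<mu> (f -` E)\<bar> = ennreal \<bar>\<nu> E\<bar>"
      using b by (simp add: ennreal_mult' abs_mult)
  qed simp
  finally show "(\<Sum>E\<in>P. ennreal \<bar>\<nu> E\<bar>) \<le> ennreal b * variation \<mu> Q" .
qed

lemma variation_empty:
  fixes \<mu> :: "'a::topological_space set \<Rightarrow> real"
  shows "variation \<mu> {} = 0"
proof -
  have "variation \<mu> {} \<le> 0"
    unfolding variation_def
  proof (rule SUP_least)
    fix P :: "'a set set" assume "P \<in> {P. finite P \<and> P \<subseteq> sets borel \<and> partition_on {} P}"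
    then have "P = {}"
      by (auto simp: partition_on_def)
    then show "(\<Sum>E\<in>P. ennreal \<bar>\<mu> E\<bar>) \<le> 0" by simp
  qed
  then show ?thesis by simp
qed

section \<open>Parallel sets of self-similar sets\<close>

lemma closure_Int_open_cong:
  assumes "open W" "A \<inter> W = B \<inter> W"
  shows "closure A \<inter> W = closure B \<inter> W"
proof -
  have "closure A \<inter> W \<subseteq> closure B" if eq: "A \<inter> W = B \<inter> W" for A B
  proof -
    have "W \<inter> closure A \<subseteq> closure (W \<inter> A)"
      by (rule open_Int_closure_subset[OF \<open>open W\<close>])
    also have "\<dots> \<subseteq> closure B"
      using eq by (intro closure_mono) blast
    finally show ?thesis by blast
  qed
  from this[OF assms(2)] this[OF assms(2)[symmetric]] show ?thesis by blast
qed

lemma frontier_Int_open_cong: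
  assumes "open W" "A \<inter> W = B \<inter> W"
  shows "frontier A \<inter> W = frontier B \<inter> W"
proof -
  have "- A \<inter> W = - B \<inter> W"
    using assms(2) by blast
  then show ?thesis
    using closure_Int_open_cong[OF assms] closure_Int_open_cong[OF assms(1), of "- A" "- B"]
    unfolding frontier_closures by blast
qed

lemma parallel_set_iff:
  assumes "closed K"
  shows "y \<in> parallel_set K \<epsilon> \<longleftrightarrow> (\<exists>x\<in>K. dist y x \<le> \<epsilon>)"
proof
  assume "y \<in> parallel_set K \<epsilon>"
  then have "K \<noteq> {}" "infdist y K \<le> \<epsilon>"
    by (auto simp: parallel_set_def)
  moreover obtain x where "x \<in> K" "infdist y K = dist y x"
    using infdist_attains_inf[OF assms \<open>K \<noteq> {}\<close>] by blast
  ultimately show "\<exists>x\<in>K. dist y x \<le> \<epsilon>"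
    by auto
next
  assume "\<exists>x\<in>K. dist y x \<le> \<epsilon>"
  then show "y \<in> parallel_set K \<epsilon>"
    unfolding parallel_set_def using infdist_le2 by blast
qed

lemma parallel_setI: "x \<in> K \<Longrightarrow> dist y x \<le> \<epsilon> \<Longrightarrow> y \<in> parallel_set K \<epsilon>"
  unfolding parallel_set_def using infdist_le2 by blast

lemma parallel_set_mono:
  assumes "A \<subseteq> B"
  shows "parallel_set A \<epsilon> \<subseteq> parallel_set B \<epsilon>"
proof (cases "A = {}")
  case False
  with assms show ?thesis
    using order_trans[OF infdist_mono[OF assms False]] by (auto simp: parallel_set_def)
qed (simp add: parallel_set_def)

lemma closed_parallel_set: "closed (parallel_set K \<epsilon>)"
proof (cases "K = {}")
  case False
  have "closed {x. infdist x K \<le> \<epsilon>}"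
    by (intro closed_Collect_le continuous_on_infdist continuous_on_id continuous_on_const)
  with False show ?thesis
    by (simp add: parallel_set_def)
qed (simp add: parallel_set_def)

lemma compact_parallel_set:
  assumes "compact K" "0 < \<epsilon>"
  shows "compact (parallel_set K \<epsilon>)"
  using assms compact_infdist_le[of K \<epsilon>] by (cases "K = {}") (auto simp: parallel_set_def)

text \<open>The parallel set is bounded and the space is not. This provides the nonemptiness assumed
  by the scaling and locality of curvature measures.\<close>

lemma closure_Compl_parallel_set_nonempty:
  assumes "compact K" "0 < \<epsilon>"
  shows "closure (- parallel_set K \<epsilon>) \<noteq> {}"
proof -
  have "parallel_set K \<epsilon> \<noteq> UNIV"
    using compact_imp_bounded[OF compact_parallel_set[OF assms]] not_bounded_UNIV by auto
  then show ?thesis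
    by auto
qed

lemma similarity_infdist:
  assumes f: "similarity c f" and "K \<noteq> {}"
  shows "infdist (f x) (f ` K) = c * infdist x K"
proof -
  \<comment> \<open>Stated for an arbitrary similarity, since it is applied to \<open>f\<close> and
    to \<open>inv f\<close>.\<close>
  have le: "infdist (g x) (g ` K) \<le> b * infdist x K"
    if g: "similarity b g" and "K \<noteq> {}" for b and g :: "'a \<Rightarrow> 'a" and x K
  proof -
    have "infdist (g x) (g ` K) / b \<le> infdist x K"
      unfolding infdist_notempty[OF \<open>K \<noteq> {}\<close>]
    proof (rule cINF_greatest[OF \<open>K \<noteq> {}\<close>])
      fix a assume "a \<in> K"
      then have "infdist (g x) (g ` K) \<le> b * dist x a"
        using infdist_le[of "g a" "g ` K" "g x"] by (simp add: similarity_dist[OF g])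
      then show "infdist (g x) (g ` K) / b \<le> dist x a"
        using similarity_pos[OF g] by (simp add: field_simps)
    qed
    then show ?thesis
      using similarity_pos[OF g] by (simp add: field_simps)
  qed
  have "infdist x K \<le> 1 / c * infdist (f x) (f ` K)"
    using le[OF similarity_inv[OF f], of "f ` K" "f x"] \<open>K \<noteq> {}\<close>
    by (simp add: similarity_inv_image[OF f] similarity_inj[OF f])
  then have "c * infdist x K \<le> infdist (f x) (f ` K)"
    using similarity_pos[OF f] by (simp add: field_simps)
  with le[OF f \<open>K \<noteq> {}\<close>] show ?thesis
    by (simp add: antisym)
qed

lemma similarity_parallel_set:
  assumes f: "similarity c f"
  shows "parallel_set (f ` K) (c * \<epsilon>) = f ` parallel_set K \<epsilon>"
proof (cases "K = {}")
  case False
  have iff: "f x \<in> parallel_set (f ` K) (c * \<epsilon>) \<longleftrightarrow> x \<in> parallel_set K \<epsilon>" for x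
    using False similarity_pos[OF f] by (simp add: parallel_set_def similarity_infdist[OF f False])
  have "f -` parallel_set (f ` K) (c * \<epsilon>) = parallel_set K \<epsilon>"
    unfolding vimage_def iff by simp
  then show ?thesis
    using surj_image_vimage_eq[OF bij_is_surj[OF similarity_bij[OF f]]] by metis
qed (simp add: parallel_set_def)

lemma parallel_curvature_similarity:
  fixes F :: "'a::euclidean_space set"
  assumes f: "similarity c f" and F: "compact F" and \<epsilon>: "0 < \<epsilon>"
  shows "parallel_curvature k (f ` F) \<epsilon> (f ` E) = c ^ k * parallel_curvature k F (\<epsilon> / c) E"
proof -
  let ?A = "closure (- parallel_set F (\<epsilon> / c))"
  have c: "c > 0" by (rule similarity_pos[OF f])
  have "?A \<noteq> {}"
    using F \<epsilon> c by (intro closure_Compl_parallel_set_nonempty) simp_all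
  moreover have "closure (- parallel_set (f ` F) \<epsilon>) = f ` ?A"
    using similarity_parallel_set[OF f, of F "\<epsilon> / c"] c
    by (simp add: bij_image_Compl_eq[OF similarity_bij[OF f], symmetric] similarity_closure_image[OF f])
  ultimately show ?thesis
    by (simp add: parallel_curvature_def curvature_measure_similarity[OF f])
qed

lemma parallel_curvature_local:
  fixes F :: "'a::euclidean_space set"
  assumes F: "compact F" "compact F'" and \<epsilon>: "0 < \<epsilon>"
    and Q: "compact Q" "Q \<subseteq> W" and W: "open W"
    and eq: "parallel_set F \<epsilon> \<inter> W = parallel_set F' \<epsilon> \<inter> W" and "E \<subseteq> Q"
  shows "parallel_curvature k F \<epsilon> E = parallel_curvature k F' \<epsilon> E"
proof -
  note ne = closure_Compl_parallel_set_nonempty[OF _ \<epsilon>]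
  have "- parallel_set F \<epsilon> \<inter> W = - parallel_set F' \<epsilon> \<inter> W"
    using eq by blast
  then have "closure (- parallel_set F \<epsilon>) \<inter> W = closure (- parallel_set F' \<epsilon>) \<inter> W"
    by (rule closure_Int_open_cong[OF W])
  then show ?thesis
    using curvature_measure_local[OF closed_closure ne[OF F(1)] closed_closure ne[OF F(2)] Q W _ \<open>E \<subseteq> Q\<close>]
    by (simp add: parallel_curvature_def)
qed

lemma word_map_Cons: "word_map S (i # \<tau>) ` A = S i ` word_map S \<tau> ` A"
  by (simp add: word_map_def image_comp)

lemma word_ratio_Cons: "word_ratio r (i # \<tau>) = r i * word_ratio r \<tau>"
  by (simp add: word_ratio_def)

text \<open>The set on which \<open>CBC\<close> evaluates the variation, named here so that it can
  be used for words outside the boundary family and at rescaled distances.\<close>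

definition overlap ::
  "nat \<Rightarrow> (nat \<Rightarrow> 'a::euclidean_space \<Rightarrow> 'a) \<Rightarrow> (nat \<Rightarrow> real) \<Rightarrow> 'a set \<Rightarrow> real \<Rightarrow> real \<Rightarrow> nat list
    \<Rightarrow> 'a set" where
  "overlap N S r F R \<epsilon> \<sigma> =
     frontier (parallel_set (word_map S \<sigma> ` F) \<epsilon>) \<inter>
     frontier (\<Union>\<sigma>'\<in>words_at N r R \<epsilon> - {\<sigma>}. parallel_set (word_map S \<sigma>' ` F) \<epsilon>)"

context
  fixes N :: nat and S :: "nat \<Rightarrow> 'a::euclidean_space \<Rightarrow> 'a" and r :: "nat \<Rightarrow> real"
    and F :: "'a set"
  assumes F: "self_similar_set N S r F"
begin

section \<open>Cylinder sets and stopping words of the self-similar set\<close>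

lemma sim: "i \<in> {1..N} \<Longrightarrow> similarity (r i) (S i)"
  using F by (auto simp: self_similar_set_def similarity_def)

lemma ratio: "i \<in> {1..N} \<Longrightarrow> 0 < r i" "i \<in> {1..N} \<Longrightarrow> r i < 1"
  using F by (auto simp: self_similar_set_def)

lemma compact_F: "compact F" and F_nonempty: "F \<noteq> {}"
  using F by (auto simp: self_similar_set_def)

lemma F_eq: "F = (\<Union>i\<in>{1..N}. S i ` F)"
  using F unfolding self_similar_set_def by blast

lemma F_cases:
  assumes "x \<in> F"
  obtains i y where "i \<in> {1..N}" "y \<in> F" "x = S i y"
proof -
  have "x \<in> (\<Union>i\<in>{1..N}. S i ` F)"
    using assms F_eq by simp
  then show ?thesis
    using that by blast
qed

lemma image_F_subset: "i \<in> {1..N} \<Longrightarrow> S i ` F \<subseteq> F"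
  by (subst (2) F_eq) blast

lemma word_ratio_pos: "\<omega> \<in> lists {1..N} \<Longrightarrow> 0 < word_ratio r \<omega>"
  by (induction \<omega>) (auto simp: word_ratio_Cons ratio(1), simp add: word_ratio_def)

lemma word_ratio_le_one: "\<omega> \<in> lists {1..N} \<Longrightarrow> word_ratio r \<omega> \<le> 1"
proof (induction \<omega>)
  case (Cons a \<omega>)
  then show ?case
    using word_ratio_pos[of \<omega>] ratio[of a] by (auto simp: word_ratio_Cons intro!: mult_le_one)
qed (simp add: word_ratio_def)

lemma words_at_le:
  assumes "\<omega> \<in> words_at N r R \<epsilon>" "0 < \<epsilon>"
  shows "\<epsilon> \<le> R"
proof -
  have \<omega>: "butlast \<omega> \<in> lists {1..N}" "\<epsilon> \<le> R * word_ratio r (butlast \<omega>)"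
    using assms(1) by (auto simp: words_at_def dest: in_set_butlastD)
  \<comment> \<open>The sign of \<open>R\<close> is read off from the existence of a word at a
    positive distance.\<close>
  then have "0 < R * word_ratio r (butlast \<omega>)"
    using assms(2) by linarith
  then have "0 < R"
    using word_ratio_pos[OF \<omega>(1)] by (simp add: zero_less_mult_iff)
  then have "R * word_ratio r (butlast \<omega>) \<le> R"
    using word_ratio_le_one[OF \<omega>(1)] by (simp add: mult_left_le)
  with \<omega>(2) show ?thesis by simp
qed

lemma compact_word_image: "\<omega> \<in> lists {1..N} \<Longrightarrow> compact (word_map S \<omega> ` F)"
proof (induction \<omega>)
  case Nil
  then show ?case using compact_F by (simp add: word_map_def)
next
  case (Cons i \<omega>)
  then show ?case
    using compact_continuous_image[OF similarity_continuous[OF sim]] by (simp add: word_map_Cons)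
qed

lemma word_image_subset: "\<omega> \<in> lists {1..N} \<Longrightarrow> word_map S \<omega> ` F \<subseteq> F"
proof (induction \<omega>)
  case Nil
  then show ?case by (simp add: word_map_def)
next
  case (Cons i \<omega>)
  then have "word_map S (i # \<omega>) ` F \<subseteq> S i ` F"
    unfolding word_map_Cons by (intro image_mono) simp
  with Cons image_F_subset[of i] show ?case by auto
qed

lemma word_image_Cons_subset: "\<omega> \<in> lists {1..N} \<Longrightarrow> word_map S (i # \<omega>) ` F \<subseteq> S i ` F"
  unfolding word_map_Cons by (intro image_mono word_image_subset)

lemma F_subset_closure:
  assumes U: "osc_set N S U"
  shows "F \<subseteq> closure U"
proof -
  have Une: "U \<noteq> {}" and SU: "\<And>i. i \<in> {1..N} \<Longrightarrow> S i ` U \<subseteq> U"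
    using U unfolding osc_set_def by blast+
  have "continuous_on F (\<lambda>x. infdist x U)"
    by (intro continuous_on_infdist continuous_on_id)
  then obtain x where x: "x \<in> F" "\<And>y. y \<in> F \<Longrightarrow> infdist y U \<le> infdist x U"
    using continuous_attains_sup[OF compact_F F_nonempty] by metis
  obtain i y where i: "i \<in> {1..N}" and y: "y \<in> F" "x = S i y"
    using F_cases[OF x(1)] by metis
  have "infdist x U \<le> infdist x (S i ` U)"
    using SU[OF i] Une by (intro infdist_mono) auto
  also have "\<dots> = r i * infdist y U"
    unfolding y(2) by (rule similarity_infdist[OF sim[OF i] Une])
  also have "\<dots> \<le> r i * infdist x U"
    using x(2)[OF y(1)] ratio(1)[OF i] by simp
  finally have "(1 - r i) * infdist x U \<le> 0"
    by (simp add: algebra_simps)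
  then have "infdist x U \<le> 0"
    using ratio(2)[OF i] by (simp add: mult_le_0_iff)
  then have "infdist y U = 0" if "y \<in> F" for y
    using x(2)[OF that] infdist_nonneg[of y U] by simp
  then show ?thesis
    using in_closure_iff_infdist_zero[OF Une] by blast
qed

text \<open>Both defining inequalities are divided by \<open>r i\<close>. Nonemptiness of \<tau>
  matters: \<open>butlast\<close> must keep the letter \<open>i\<close>, and the empty word never
  belongs to \<open>words_at\<close>.\<close>

lemma words_at_Cons_iff:
  assumes "i \<in> {1..N}" "\<tau> \<noteq> []"
  shows "i # \<tau> \<in> words_at N r R \<epsilon> \<longleftrightarrow> \<tau> \<in> words_at N r R (\<epsilon> / r i)"
  using assms ratio(1)[OF assms(1)] by (simp add: words_at_def word_ratio_Cons field_simps)

text \<open>Every point within \<open>2\<epsilon>\<close> of \<open>S\<^sub>\<sigma> F\<close> lies in \<open>S\<^sub>i U\<close>, so the points \<open>H\<close> of \<open>F\<close> outside \<open>S\<^sub>i U\<close> do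
  not contribute to the \<open>\<epsilon>\<close>-parallel set near \<open>S\<^sub>\<sigma> F\<close>; the complement of \<open>H\<^sub>\<epsilon>\<close> is the required
  neighbourhood.\<close>

lemma nonboundary_neighbourhood:
  assumes U: "osc_set N S U" and \<epsilon>: "0 < \<epsilon>"
    and \<sigma>: "i # \<tau> \<in> words_at N r R \<epsilon>" "i # \<tau> \<notin> boundary_words N S r F R U \<epsilon>"
  obtains W where "open W" "parallel_set (word_map S (i # \<tau>) ` F) \<epsilon> \<subseteq> W"
    "parallel_set F \<epsilon> \<inter> W = parallel_set (S i ` F) \<epsilon> \<inter> W"
    "\<forall>j\<in>{1..N} - {i}. \<forall>\<rho>\<in>lists {1..N}. parallel_set (word_map S (j # \<rho>) ` F) \<epsilon> \<inter> W = {}"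
proof -
  let ?E = "word_map S (i # \<tau>) ` F"
  define G where "G = S i ` U"
  define G' where "G' = (\<Union>j\<in>{1..N} - {i}. S j ` U)"
  define H where "H = F - G"
  have i: "i \<in> {1..N}" and \<tau>: "\<tau> \<in> lists {1..N}"
    using \<sigma>(1) by (auto simp: words_at_def)
  have "open U" and disj: "\<And>j. j \<in> {1..N} \<Longrightarrow> j \<noteq> i \<Longrightarrow> S j ` U \<inter> G = {}"
    using U i unfolding osc_set_def G_def by blast+
  have SU: "(\<Union>j\<in>{1..N}. S j ` U) = G \<union> G'"
    using i by (auto simp: G_def G'_def)
  have open_SU: "open (S j ` U)" if "j \<in> {1..N}" for j
    by (rule similarity_open_image[OF sim[OF that] \<open>open U\<close>])
  have G: "open G" "open G'" "G \<inter> G' = {}"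
    using i open_SU disj unfolding G'_def by (auto simp: G_def) blast
  have SF: "S j ` F \<subseteq> closure (S j ` U)" if "j \<in> {1..N}" for j
    unfolding similarity_closure_image[OF sim[OF that]] by (intro image_mono F_subset_closure U)
  have sub: "cball e (2 * \<epsilon>) \<subseteq> G" if e: "e \<in> ?E" for e
  proof -
    have cov: "cball e (2 * \<epsilon>) \<subseteq> G \<union> G'"
    proof (rule subsetI, rule ccontr)
      fix y assume y: "y \<in> cball e (2 * \<epsilon>)" "y \<notin> G \<union> G'"
      \<comment> \<open>The midpoint would lie in both parallel sets of the definition and make the
        word a boundary word.\<close>
      have "dist (midpoint e y) e \<le> \<epsilon>" "dist (midpoint e y) y \<le> \<epsilon>"
        using y(1) by (auto simp: dist_midpoint)
      then have "midpoint e y \<in> parallel_set ?E \<epsilon> \<inter> parallel_set (- (\<Union>j\<in>{1..N}. S j ` U)) \<epsilon>"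
        using e y(2) SU by (auto intro: parallel_setI)
      then show False
        using \<sigma> by (auto simp: boundary_words_def)
    qed
    have "e \<in> closure G"
      using e word_image_Cons_subset[OF \<tau>, of i] SF[OF i] by (auto simp: G_def)
    moreover have "G' \<inter> closure G = {}"
      using G open_Int_closure_eq_empty[of G' G] by blast
    moreover have "e \<in> cball e (2 * \<epsilon>)"
      using \<epsilon> by simp
    ultimately have "e \<in> G \<inter> cball e (2 * \<epsilon>)"
      using cov by blast
    \<comment> \<open>The ball is connected and covered by the disjoint open sets \<open>G\<close>
      and \<open>G'\<close>. It meets \<open>G\<close> at its centre, so it lies in
      \<open>G\<close>.\<close>
    moreover have "G \<inter> cball e (2 * \<epsilon>) = {} \<or> G' \<inter> cball e (2 * \<epsilon>) = {}"
      using G cov by (intro connectedD) auto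
    ultimately show ?thesis
      using cov by blast
  qed
  \<comment> \<open>The other pieces lie in the closures of sets disjoint from the open set
    \<open>G\<close>, hence miss \<open>G\<close>.\<close>
  have SjH: "S j ` F \<subseteq> H" if "j \<in> {1..N}" "j \<noteq> i" for j
  proof -
    have "G \<inter> closure (S j ` U) = {}"
      using disj[OF that] open_Int_closure_eq_empty[OF G(1)] by blast
    then show ?thesis
      using SF[OF that(1)] image_F_subset[OF that(1)] unfolding H_def by blast
  qed
  have "closed H"
    unfolding H_def using compact_imp_closed[OF compact_F] G(1) by (rule closed_Diff)
  show ?thesis
  proof (rule that[of "- parallel_set H \<epsilon>"])
    show "open (- parallel_set H \<epsilon>)"
      by (simp add: closed_parallel_set open_Compl)
    show "parallel_set ?E \<epsilon> \<subseteq> - parallel_set H \<epsilon>"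
    proof
      fix z assume "z \<in> parallel_set ?E \<epsilon>"
      moreover have "closed ?E"
        using compact_word_image[of "i # \<tau>"] i \<tau> by (intro compact_imp_closed) auto
      ultimately obtain e where e: "e \<in> ?E" "dist z e \<le> \<epsilon>"
        by (auto simp: parallel_set_iff)
      show "z \<in> - parallel_set H \<epsilon>"
      proof
        assume "z \<in> parallel_set H \<epsilon>"
        then obtain h where h: "h \<in> H" "dist z h \<le> \<epsilon>"
          using parallel_set_iff[OF \<open>closed H\<close>] by blast
        have "dist e h \<le> 2 * \<epsilon>"
          using dist_triangle3[of e h z] e h by simp
        then show False
          using sub[OF e(1)] h(1) by (auto simp: H_def)
      qed
    qed
    have "parallel_set F \<epsilon> \<inter> - parallel_set H \<epsilon> \<subseteq> parallel_set (S i ` F) \<epsilon>"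
    proof
      fix z assume z: "z \<in> parallel_set F \<epsilon> \<inter> - parallel_set H \<epsilon>"
      then obtain x where x: "x \<in> F" "dist z x \<le> \<epsilon>"
        using parallel_set_iff[OF compact_imp_closed[OF compact_F]] by blast
      obtain j where j: "j \<in> {1..N}" "x \<in> S j ` F"
        using F_cases[OF x(1)] by (metis imageI)
      have "j = i"
      proof (rule ccontr)
        assume "j \<noteq> i"
        then have "z \<in> parallel_set H \<epsilon>"
          using SjH[OF j(1)] j(2) x(2) by (intro parallel_setI[of x]) auto
        with z show False by simp
      qed
      with j x(2) show "z \<in> parallel_set (S i ` F) \<epsilon>"
        using parallel_setI[of x] by simp
    qed
    moreover have "parallel_set (S i ` F) \<epsilon> \<subseteq> parallel_set F \<epsilon>"
      by (intro parallel_set_mono image_F_subset i)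
    ultimately show "parallel_set F \<epsilon> \<inter> - parallel_set H \<epsilon> =
        parallel_set (S i ` F) \<epsilon> \<inter> - parallel_set H \<epsilon>"
      by blast
    show "\<forall>j\<in>{1..N} - {i}. \<forall>\<rho>\<in>lists {1..N}.
        parallel_set (word_map S (j # \<rho>) ` F) \<epsilon> \<inter> - parallel_set H \<epsilon> = {}"
    proof (intro ballI)
      fix j \<rho> assume "j \<in> {1..N} - {i}" "\<rho> \<in> lists {1..N}"
      then have "word_map S (j # \<rho>) ` F \<subseteq> H"
        using word_image_Cons_subset[of \<rho> j] SjH[of j] by auto
      then show "parallel_set (word_map S (j # \<rho>) ` F) \<epsilon> \<inter> - parallel_set H \<epsilon> = {}"
        using parallel_set_mono by blast
    qed
  qed
qed

section \<open>Removing the first letter of a nonboundary word\<close>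

lemma overlap_single_nonboundary:
  assumes U: "osc_set N S U" and \<epsilon>: "0 < \<epsilon>"
    and \<sigma>: "[i] \<in> words_at N r R \<epsilon>" "[i] \<notin> boundary_words N S r F R U \<epsilon>"
  shows "overlap N S r F R \<epsilon> [i] = {}"
proof -
  let ?X = "parallel_set (word_map S [i] ` F) \<epsilon>"
  let ?Y = "\<Union>\<sigma>'\<in>words_at N r R \<epsilon> - {[i]}. parallel_set (word_map S \<sigma>' ` F) \<epsilon>"
  obtain W where W: "open W" "?X \<subseteq> W"
    and "parallel_set F \<epsilon> \<inter> W = parallel_set (S i ` F) \<epsilon> \<inter> W"
    and disj: "\<forall>j\<in>{1..N} - {i}. \<forall>\<rho>\<in>lists {1..N}. parallel_set (word_map S (j # \<rho>) ` F) \<epsilon> \<inter> W = {}"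
    by (rule nonboundary_neighbourhood[OF U \<epsilon> \<sigma>])
  have i: "i \<in> {1..N}" and lt: "R * r i < \<epsilon>" "\<epsilon> \<le> R"
    using \<sigma>(1) by (auto simp: words_at_def word_ratio_def)
  have "?Y \<inter> W = {} \<inter> W"
  proof -
    have "parallel_set (word_map S \<sigma>' ` F) \<epsilon> \<inter> W = {}"
      if \<sigma>': "\<sigma>' \<in> words_at N r R \<epsilon>" "\<sigma>' \<noteq> [i]" for \<sigma>'
    proof (cases \<sigma>')
      case (Cons j \<rho>)
      \<comment> \<open>No other stopping word begins with \<open>i\<close>: its tail would be a
        stopping word at \<open>\<epsilon> / r i\<close>, forcing
        \<open>\<epsilon> \<le> R * r i\<close>, whereas \<open>[i]\<close> requires
        \<open>R * r i < \<epsilon>\<close>.\<close>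
      have "j \<noteq> i"
      proof
        assume "j = i"
        with Cons \<sigma>' have \<rho>: "\<rho> \<noteq> []" "\<rho> \<in> words_at N r R (\<epsilon> / r i)"
          using words_at_Cons_iff[OF i] by auto
        then have "\<epsilon> / r i \<le> R"
          using words_at_le \<epsilon> ratio(1)[OF i] by simp
        then show False
          using lt(1) ratio(1)[OF i] by (simp add: field_simps)
      qed
      with Cons \<sigma>'(1) show ?thesis
        using disj by (auto simp: words_at_def)
    qed (use \<sigma>' in \<open>simp add: words_at_def\<close>)
    then show ?thesis by blast
  qed
  then have "frontier ?Y \<inter> W = {}"
    using frontier_Int_open_cong[OF W(1), of ?Y "{}"] by simp
  moreover have "frontier ?X \<subseteq> W"
    using W(2) frontier_subset_closed[OF closed_parallel_set] by blast
  ultimately show ?thesis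
    unfolding overlap_def by blast
qed

text \<open>Inside \<open>W\<close> only words with first letter \<open>i\<close> contribute, and
  deleting that letter turns them into the stopping words at \<open>\<epsilon> / r i\<close>.
  Frontiers are local and commute with \<open>S i\<close>.\<close>

lemma overlap_Cons_nonboundary:
  assumes \<epsilon>: "0 < \<epsilon>" and \<sigma>: "i # \<tau> \<in> words_at N r R \<epsilon>" and "\<tau> \<noteq> []"
    and W: "open W" "parallel_set (word_map S (i # \<tau>) ` F) \<epsilon> \<subseteq> W"
    and disj: "\<forall>j\<in>{1..N} - {i}. \<forall>\<rho>\<in>lists {1..N}. parallel_set (word_map S (j # \<rho>) ` F) \<epsilon> \<inter> W = {}"
  shows "overlap N S r F R \<epsilon> (i # \<tau>) = S i ` overlap N S r F R (\<epsilon> / r i) \<tau>"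
proof -
  let ?X = "parallel_set (word_map S (i # \<tau>) ` F) \<epsilon>"
  let ?Y = "\<Union>\<sigma>'\<in>words_at N r R \<epsilon> - {i # \<tau>}. parallel_set (word_map S \<sigma>' ` F) \<epsilon>"
  let ?T = "parallel_set (word_map S \<tau> ` F) (\<epsilon> / r i)"
  let ?V = "\<Union>\<tau>'\<in>words_at N r R (\<epsilon> / r i) - {\<tau>}. parallel_set (word_map S \<tau>' ` F) (\<epsilon> / r i)"
  have i: "i \<in> {1..N}"
    using \<sigma> by (auto simp: words_at_def)
  have im: "parallel_set (word_map S (i # \<rho>) ` F) \<epsilon> =
      S i ` parallel_set (word_map S \<rho> ` F) (\<epsilon> / r i)" for \<rho>
    using similarity_parallel_set[OF sim[OF i], of "word_map S \<rho> ` F" "\<epsilon> / r i"] ratio(1)[OF i]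
    by (simp add: word_map_Cons)
  \<comment> \<open>This excludes \<open>[i]\<close> from the stopping words, so that below every
    tail \<rho> is nonempty.\<close>
  have R: "R * r i \<ge> \<epsilon>"
  proof -
    have "\<epsilon> / r i \<le> R"
      using \<sigma> words_at_Cons_iff[OF i \<open>\<tau> \<noteq> []\<close>] words_at_le \<epsilon> ratio(1)[OF i] by simp
    then show ?thesis
      using ratio(1)[OF i] by (simp add: field_simps)
  qed
  have "?Y \<inter> W = S i ` ?V \<inter> W"
  proof (intro subset_antisym subsetI)
    fix z assume z: "z \<in> ?Y \<inter> W"
    then obtain \<sigma>' where \<sigma>': "\<sigma>' \<in> words_at N r R \<epsilon>" "\<sigma>' \<noteq> i # \<tau>"
      "z \<in> parallel_set (word_map S \<sigma>' ` F) \<epsilon>" by blast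
    then obtain j \<rho> where j\<rho>: "\<sigma>' = j # \<rho>" "j \<in> {1..N}" "\<rho> \<in> lists {1..N}"
      by (cases \<sigma>') (auto simp: words_at_def)
    then have "j = i"
      using disj \<sigma>'(3) z by blast
    moreover have "\<rho> \<noteq> []"
      using \<sigma>'(1) R calculation j\<rho>(1) by (auto simp: words_at_def word_ratio_def)
    ultimately have "\<rho> \<in> words_at N r R (\<epsilon> / r i) - {\<tau>}"
      using \<sigma>' j\<rho> words_at_Cons_iff[OF i] by auto
    moreover have "z \<in> S i ` parallel_set (word_map S \<rho> ` F) (\<epsilon> / r i)"
      using \<sigma>'(3) unfolding j\<rho>(1) \<open>j = i\<close> im .
    ultimately show "z \<in> S i ` ?V \<inter> W"
      using z by blast
  next
    fix z assume z: "z \<in> S i ` ?V \<inter> W"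
    then obtain \<rho> where "\<rho> \<in> words_at N r R (\<epsilon> / r i)" "\<rho> \<noteq> \<tau>"
      "z \<in> S i ` parallel_set (word_map S \<rho> ` F) (\<epsilon> / r i)"
      by blast
    then have \<rho>: "\<rho> \<in> words_at N r R (\<epsilon> / r i)" "\<rho> \<noteq> \<tau>"
      "z \<in> parallel_set (word_map S (i # \<rho>) ` F) \<epsilon>"
      unfolding im by simp_all
    then have "i # \<rho> \<in> words_at N r R \<epsilon> - {i # \<tau>}"
      using words_at_Cons_iff[OF i, of \<rho>] by (auto simp: words_at_def)
    with \<rho> z show "z \<in> ?Y \<inter> W" by blast
  qed
  then have "frontier ?Y \<inter> W = frontier (S i ` ?V) \<inter> W"
    by (rule frontier_Int_open_cong[OF W(1)])
  moreover have "frontier ?X \<subseteq> W"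
    using W(2) frontier_subset_closed[OF closed_parallel_set] by blast
  ultimately have "overlap N S r F R \<epsilon> (i # \<tau>) = frontier ?X \<inter> frontier (S i ` ?V)"
    unfolding overlap_def by blast
  also have "\<dots> = S i ` (frontier ?T \<inter> frontier ?V)"
    unfolding im similarity_frontier_image[OF sim[OF i]]
    by (rule image_Int[OF similarity_inj[OF sim[OF i]], symmetric])
  finally show ?thesis
    unfolding overlap_def .
qed

lemma curvature_overlap_Cons_le:
  assumes U: "osc_set N S U" and \<epsilon>: "0 < \<epsilon>" and "\<tau> \<noteq> []"
    and \<sigma>: "i # \<tau> \<in> words_at N r R \<epsilon>" "i # \<tau> \<notin> boundary_words N S r F R U \<epsilon>"
  shows "parallel_curvature_var k F \<epsilon> (overlap N S r F R \<epsilon> (i # \<tau>))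
    \<le> ennreal (r i ^ k) *
      parallel_curvature_var k F (\<epsilon> / r i) (overlap N S r F R (\<epsilon> / r i) \<tau>)"
proof -
  let ?X = "parallel_set (word_map S (i # \<tau>) ` F) \<epsilon>"
  let ?Q = "overlap N S r F R (\<epsilon> / r i) \<tau>"
  have i: "i \<in> {1..N}" and \<tau>: "\<tau> \<in> lists {1..N}"
    using \<sigma>(1) by (auto simp: words_at_def)
  obtain W where W: "open W" "?X \<subseteq> W"
    and FW: "parallel_set F \<epsilon> \<inter> W = parallel_set (S i ` F) \<epsilon> \<inter> W"
    and disj: "\<forall>j\<in>{1..N} - {i}. \<forall>\<rho>\<in>lists {1..N}. parallel_set (word_map S (j # \<rho>) ` F) \<epsilon> \<inter> W = {}"
    by (rule nonboundary_neighbourhood[OF U \<epsilon> \<sigma>])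
  have Q: "overlap N S r F R \<epsilon> (i # \<tau>) = S i ` ?Q"
    by (rule overlap_Cons_nonboundary[OF \<epsilon> \<sigma>(1) \<open>\<tau> \<noteq> []\<close> W disj])
  \<comment> \<open>The overlap is a closed subset of the compact set \<open>?X\<close>, hence a
    compact subset of \<open>W\<close>, as locality demands.\<close>
  have sub: "S i ` ?Q \<subseteq> ?X"
    unfolding Q[symmetric] unfolding overlap_def using frontier_subset_closed[OF closed_parallel_set] by blast
  have "compact ?X"
    using i \<tau> by (intro compact_parallel_set compact_word_image \<epsilon>) simp
  moreover have "closed (S i ` ?Q)"
    unfolding Q[symmetric] unfolding overlap_def by (intro closed_Int frontier_closed)
  ultimately have "compact (S i ` ?Q)"
    using sub by (metis compact_Int_closed inf.absorb2)
  moreover have "compact (S i ` F)"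
    by (intro compact_continuous_image similarity_continuous[OF sim[OF i]] compact_F)
  ultimately have "parallel_curvature k F \<epsilon> (S i ` E) = r i ^ k * parallel_curvature k F (\<epsilon> / r i) E"
    if "E \<subseteq> ?Q" for E
    using parallel_curvature_local[OF compact_F _ \<epsilon> _ _ W(1) FW, of "S i ` ?Q" "S i ` E"] sub W(2)
      image_mono[OF that, of "S i"] parallel_curvature_similarity[OF sim[OF i] compact_F \<epsilon>]
    by auto
  then show ?thesis
    unfolding parallel_curvature_var_def Q using ratio(1)[OF i]
    by (intro variation_similarity_le[OF sim[OF i]]) auto
qed

text \<open>Deleting a prefix \<omega> moves the distance to
  \<open>\<epsilon> / word_ratio r \<omega>\<close>, so the bound for boundary words is assumed at
  all these distances. The induction on the word keeps the constant \<open>c\<close>.\<close>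

lemma curvature_overlap_bound:
  assumes U: "osc_set N S U"
    and bound: "\<And>\<omega> \<rho>. \<omega> \<in> lists {1..N} \<Longrightarrow> \<epsilon> / word_ratio r \<omega> \<le> R \<Longrightarrow>
      \<rho> \<in> boundary_words N S r F R U (\<epsilon> / word_ratio r \<omega>) \<Longrightarrow>
      parallel_curvature_var k F (\<epsilon> / word_ratio r \<omega>) (overlap N S r F R (\<epsilon> / word_ratio r \<omega>) \<rho>)
        \<le> ennreal (c * (\<epsilon> / word_ratio r \<omega>) ^ k)"
    and "0 < \<epsilon>" "\<sigma> \<in> words_at N r R \<epsilon>"
  shows "parallel_curvature_var k F \<epsilon> (overlap N S r F R \<epsilon> \<sigma>) \<le> ennreal (c * \<epsilon> ^ k)"
  using bound \<open>0 < \<epsilon>\<close> \<open>\<sigma> \<in> words_at N r R \<epsilon>\<close>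
proof (induction \<sigma> arbitrary: \<epsilon>)
  case Nil
  then show ?case by (simp add: words_at_def)
next
  case (Cons i \<tau>)
  have \<epsilon>: "0 < \<epsilon>" by fact
  have i: "i \<in> {1..N}" and \<tau>: "\<tau> \<in> lists {1..N}"
    using Cons.prems(3) by (auto simp: words_at_def)
  show ?case
  proof (cases "i # \<tau> \<in> boundary_words N S r F R U \<epsilon>")
    case True
    \<comment> \<open>The empty prefix gives the distance \<epsilon> itself.\<close>
    then show ?thesis
      using Cons.prems(1)[of "[]"] words_at_le[OF Cons.prems(3) \<epsilon>] by (simp add: word_ratio_def)
  next
    case nb: False
    show ?thesis
    proof (cases "\<tau> = []")
      case True
      then show ?thesis
        using overlap_single_nonboundary[OF U \<epsilon>] nb Cons.prems(3)
        by (simp add: parallel_curvature_var_def variation_empty)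
    next
      case False
      have "parallel_curvature_var k F (\<epsilon> / r i) (overlap N S r F R (\<epsilon> / r i) \<tau>)
          \<le> ennreal (c * (\<epsilon> / r i) ^ k)"
      proof (rule Cons.IH)
        show "0 < \<epsilon> / r i"
          using \<epsilon> ratio(1)[OF i] by simp
        show "\<tau> \<in> words_at N r R (\<epsilon> / r i)"
          using Cons.prems(3) words_at_Cons_iff[OF i False] by blast
        \<comment> \<open>A prefix \<omega> of the shorter word corresponds to the prefix
          \<open>i # \<omega>\<close> at the original distance.\<close>
        fix \<omega> \<rho> assume "\<omega> \<in> lists {1..N}" "\<epsilon> / r i / word_ratio r \<omega> \<le> R"
          "\<rho> \<in> boundary_words N S r F R U (\<epsilon> / r i / word_ratio r \<omega>)"
        then show "parallel_curvature_var k F (\<epsilon> / r i / word_ratio r \<omega>)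
            (overlap N S r F R (\<epsilon> / r i / word_ratio r \<omega>) \<rho>)
            \<le> ennreal (c * (\<epsilon> / r i / word_ratio r \<omega>) ^ k)"
          using Cons.prems(1)[of "i # \<omega>" \<rho>] i by (simp add: word_ratio_Cons)
      qed
      then have "ennreal (r i ^ k) *
          parallel_curvature_var k F (\<epsilon> / r i) (overlap N S r F R (\<epsilon> / r i) \<tau>)
          \<le> ennreal (r i ^ k) * ennreal (c * (\<epsilon> / r i) ^ k)"
        by (rule mult_left_mono) simp
      \<comment> \<open>The scaling factor cancels exactly against the larger distance, so the bound
        does not grow with the length of the word.\<close>
      also have "\<dots> = ennreal (c * \<epsilon> ^ k)"
        using ratio(1)[OF i] by (simp add: ennreal_mult'[symmetric] power_divide)
      finally show ?thesis
        using curvature_overlap_Cons_le[OF U \<epsilon> False Cons.prems(3) nb] by (rule order_trans[rotated])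
    qed
  qed
qed

text \<open>The induction needs the boundary bound at \<epsilon> divided by every word ratio
  simultaneously. For one word the bad distances lie in a scaled copy of the null set
  \<open>Z\<close>, and there are only countably many words.\<close>

lemma CBC_all_words:
  assumes U: "osc_set N S U" and cbc: "CBC N S r F R k U"
  obtains c where "AE \<epsilon> in lebesgue. 0 < \<epsilon> \<longrightarrow>
    (\<forall>\<sigma>\<in>words_at N r R \<epsilon>.
       parallel_curvature_var k F \<epsilon> (overlap N S r F R \<epsilon> \<sigma>) \<le> ennreal (c * \<epsilon> ^ k))"
proof -
  obtain c where c: "AE \<epsilon> in lebesgue. 0 < \<epsilon> \<and> \<epsilon> < R \<longrightarrow>
      (\<forall>\<sigma>\<in>boundary_words N S r F R U \<epsilon>.
         parallel_curvature_var k F \<epsilon> (overlap N S r F R \<epsilon> \<sigma>) \<le> ennreal (c * \<epsilon> ^ k))"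
    using cbc unfolding CBC_def overlap_def by (rule exE)
  \<comment> \<open>A rescaled distance may equal \<open>R\<close>, which \<open>CBC\<close> leaves
    out; the endpoint is included here at the cost of the null set \<open>{R}\<close>.\<close>
  define good where "good \<epsilon> \<longleftrightarrow> (0 < \<epsilon> \<and> \<epsilon> \<le> R \<longrightarrow>
      (\<forall>\<sigma>\<in>boundary_words N S r F R U \<epsilon>.
         parallel_curvature_var k F \<epsilon> (overlap N S r F R \<epsilon> \<sigma>) \<le> ennreal (c * \<epsilon> ^ k)))" for \<epsilon>
  have "AE \<epsilon> in lebesgue. \<epsilon> \<noteq> R"
    by (rule AE_I'[of "{R}"]) (auto simp: negligible_iff_null_sets[symmetric])
  with c have "AE \<epsilon> in lebesgue. good \<epsilon>"
    by eventually_elim (auto simp: good_def)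
  then obtain Z where Z: "{\<epsilon>. \<not> good \<epsilon>} \<subseteq> Z" "Z \<in> null_sets lebesgue"
    by (elim AE_E3) auto
  have "AE \<epsilon> in lebesgue. good (\<epsilon> / word_ratio r \<omega>)" if \<omega>: "\<omega> \<in> lists {1..N}" for \<omega>
  proof (rule AE_I'[of "(\<lambda>x. word_ratio r \<omega> * x) ` Z"])
    show "(\<lambda>x. word_ratio r \<omega> * x) ` Z \<in> null_sets lebesgue"
      unfolding negligible_iff_null_sets[symmetric]
    proof (rule similarity_negligible_image)
      show "similarity (word_ratio r \<omega>) (\<lambda>x::real. word_ratio r \<omega> * x)"
        using word_ratio_pos[OF \<omega>]
        by (simp add: similarity_def dist_real_def right_diff_distrib[symmetric] abs_mult)
    qed (simp add: negligible_iff_null_sets Z(2))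
    show "{\<epsilon> \<in> space lebesgue. \<not> good (\<epsilon> / word_ratio r \<omega>)} \<subseteq> (\<lambda>x. word_ratio r \<omega> * x) ` Z"
    proof
      fix \<epsilon> assume "\<epsilon> \<in> {\<epsilon> \<in> space lebesgue. \<not> good (\<epsilon> / word_ratio r \<omega>)}"
      then show "\<epsilon> \<in> (\<lambda>x. word_ratio r \<omega> * x) ` Z"
        using Z(1) word_ratio_pos[OF \<omega>]
        by (intro image_eqI[of _ _ "\<epsilon> / word_ratio r \<omega>"]) auto
    qed
  qed
  then have "AE \<epsilon> in lebesgue. \<forall>\<omega>\<in>lists {1..N}. good (\<epsilon> / word_ratio r \<omega>)"
    by (subst AE_ball_countable) auto
  then have "AE \<epsilon> in lebesgue. 0 < \<epsilon> \<longrightarrow>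
    (\<forall>\<sigma>\<in>words_at N r R \<epsilon>.
       parallel_curvature_var k F \<epsilon> (overlap N S r F R \<epsilon> \<sigma>) \<le> ennreal (c * \<epsilon> ^ k))"
  proof eventually_elim
    case (elim \<epsilon>)
    show ?case
    proof (intro impI ballI)
      fix \<sigma> assume "0 < \<epsilon>" "\<sigma> \<in> words_at N r R \<epsilon>"
      then show "parallel_curvature_var k F \<epsilon> (overlap N S r F R \<epsilon> \<sigma>) \<le> ennreal (c * \<epsilon> ^ k)"
      proof (rule curvature_overlap_bound[OF U, rotated])
        fix \<omega> \<rho> assume \<omega>: "\<omega> \<in> lists {1..N}" "\<epsilon> / word_ratio r \<omega> \<le> R"
          "\<rho> \<in> boundary_words N S r F R U (\<epsilon> / word_ratio r \<omega>)"
        have "good (\<epsilon> / word_ratio r \<omega>)"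
          using elim \<omega>(1) by (rule bspec)
        moreover have "0 < \<epsilon> / word_ratio r \<omega>"
          using \<open>0 < \<epsilon>\<close> word_ratio_pos[OF \<omega>(1)] by simp
        ultimately show "parallel_curvature_var k F (\<epsilon> / word_ratio r \<omega>)
            (overlap N S r F R (\<epsilon> / word_ratio r \<omega>) \<rho>)
            \<le> ennreal (c * (\<epsilon> / word_ratio r \<omega>) ^ k)"
          using \<omega>(2,3) unfolding good_def by simp
      qed
    qed
  qed
  then show ?thesis by (rule that)
qed

text \<open>The bound for all stopping words does not mention the open set, and the boundary words
  of any \<open>V\<close> are among them.\<close>

lemma CBC_transfer:
  assumes "osc_set N S U" "CBC N S r F R k U"
  shows "CBC N S r F R k V"
proof -
  obtain c where c: "AE \<epsilon> in lebesgue. 0 < \<epsilon> \<longrightarrow>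
    (\<forall>\<sigma>\<in>words_at N r R \<epsilon>.
       parallel_curvature_var k F \<epsilon> (overlap N S r F R \<epsilon> \<sigma>) \<le> ennreal (c * \<epsilon> ^ k))"
    by (rule CBC_all_words[OF assms])
  show ?thesis
    unfolding CBC_def overlap_def[symmetric]
  proof (rule exI[of _ c])
    show "AE \<epsilon> in lebesgue. 0 < \<epsilon> \<and> \<epsilon> < R \<longrightarrow>
      (\<forall>\<sigma>\<in>boundary_words N S r F R V \<epsilon>.
         parallel_curvature_var k F \<epsilon> (overlap N S r F R \<epsilon> \<sigma>) \<le> ennreal (c * \<epsilon> ^ k))"
      using c
    proof eventually_elim
      case (elim \<epsilon>)
      moreover have "boundary_words N S r F R V \<epsilon> \<subseteq> words_at N r R \<epsilon>"
        unfolding boundary_words_def by blast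
      ultimately show ?case
        by blast
    qed
  qed
qed

end

theorem corollary4p8:
  fixes N :: nat and S :: "nat \<Rightarrow> 'a::euclidean_space \<Rightarrow> 'a" and r :: "nat \<Rightarrow> real"
    and F O1 O2 :: "'a set" and R :: real and k :: nat
  assumes "DIM('a) \<ge> 2" and "k \<le> DIM('a) - 2"
    and "self_similar_set N S r F"
    and "OSC N S"
    and "RC F"
    and "R > sqrt 2 * diameter F"
    and "sosc_set N S F O1" and "sosc_set N S F O2"
  shows "CBC N S r F R k O1 \<longleftrightarrow> CBC N S r F R k O2"
proof
  have osc: "osc_set N S O1" "osc_set N S O2"
    using assms(7,8) unfolding sosc_set_def by simp_all
  show "CBC N S r F R k O2" if "CBC N S r F R k O1"
    by (rule CBC_transfer[OF assms(3) osc(1) that])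
  show "CBC N S r F R k O1" if "CBC N S r F R k O2"
    by (rule CBC_transfer[OF assms(3) osc(2) that])
qed

end
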